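(* Let $\varphi:\,]a,+\infty[\,\to\mathbb{R}$ be a smooth function with $\dot\varphi>0$ and $\ddot\varphi\ge 0$ on $]a,+\infty[$, such that for all sufficiently large $u$ $$\dot{\varphi}(u)=\alpha u+\beta+\sum_{n=1}^{\infty}\frac{a_n}{u^n},\qquad a_n\in\mathbb{R},$$ where either $\alpha>0$ and the first non-vanishing $a_k$ (if any) is positive, or $\alpha=0$, $\beta>0$ and the first non-vanishing $a_k$ (if any) is negative. Let $u=u(r)$ be a rotationally symmetric $[\varphi,\vec e_3]$-minimal graph, i.e. a solution on $[r_0,+\infty[$, $r_0\ge 0$, of $$u''=(1+u'^2)\left(\dot\varphi(u)-\frac{u'}{r}\right),\qquad u(r_0)=u_0>a,\quad u'(r_0)=u_1\ge 0 .$$ Then, as $r\to+\infty$: (i) if $\alpha>0$, there is a constant $C>0$ such that $$\varphi(u(r))=C\,e^{\alpha r^2}+O(r^2);$$ (ii) if $\alpha=0$, then, up to an additive constant, $$\mathcal{G}(u(r))=\frac{r^2}{2}-\frac{1}{\beta^2}\log r+O(r^{-2}),$$ where $\mathcal{G}$ is the strictly increasing function $\mathcal{G}(u)=\int_{u_0}^{u}\frac{d\xi}{\dot\varphi(\xi)}$.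
   Context: A dot denotes the derivative of $\varphi$ with respect to its (height) variable and a prime denotes $d/dr$, $r=\sqrt{x^2+y^2}$. A function $u$ on a planar domain is $[\varphi,\vec e_3]$-minimal if $$(1+u_x^2)u_{yy}+(1+u_y^2)u_{xx}-2u_xu_yu_{xy}=\dot\varphi(u)(1+u_x^2+u_y^2);$$ for $u=u(r)$ this is the ODE in the statement. When $r_0=0$ the initial condition is $u'(0)=0$ and the solution is understood to be $C^2$ up to $r=0$. "Up to an additive constant" means that there is a constant $c\in\mathbb{R}$ such that $\mathcal{G}(u(r))-c$ has the displayed expansion. *)

theory Defs
  imports "HOL-Analysis.Analysis" "HOL-Library.Landau_Symbols"
begin

text \<open>For an open set \<open>S\<close>, this is \<open>C\<^sup>\<infinity>\<close> smoothness on \<open>S\<close>; the values of \<open>f\<close> outside \<open>S\<close> are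
  irrelevant, because \<^term>\<open>deriv\<close> is local.\<close>

definition smooth_on :: "real set \<Rightarrow> (real \<Rightarrow> real) \<Rightarrow> bool" where
  "smooth_on S f \<longleftrightarrow> (\<forall>n. \<forall>x\<in>S. (deriv ^^ n) f differentiable (at x))"

text \<open>The domain of \<open>\<phi>\<close>. The endpoint is an extended real, so that \<open>a = -\<infinity>\<close> is allowed.\<close>

definition right_ray :: "ereal \<Rightarrow> real set" where
  "right_ray a = {x. a < ereal x}"

text \<open>The sign of the first non-vanishing coefficient \<open>a\<^sub>k\<close>, \<open>k \<ge> 1\<close>. Both predicates hold when
  all these coefficients vanish; the value at index 0 plays no role.\<close>

definition first_nonzero_pos :: "(nat \<Rightarrow> real) \<Rightarrow> bool" where
  "first_nonzero_pos c \<longleftrightarrow>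
    (\<forall>k\<ge>1. c k \<noteq> 0 \<and> (\<forall>j. 1 \<le> j \<and> j < k \<longrightarrow> c j = 0) \<longrightarrow> c k > 0)"

definition first_nonzero_neg :: "(nat \<Rightarrow> real) \<Rightarrow> bool" where
  "first_nonzero_neg c \<longleftrightarrow>
    (\<forall>k\<ge>1. c k \<noteq> 0 \<and> (\<forall>j. 1 \<le> j \<and> j < k \<longrightarrow> c j = 0) \<longrightarrow> c k < 0)"

text \<open>The profile \<open>u\<close> of a rotationally symmetric graph over \<open>[r\<^sub>0, \<infinity>)\<close>, with heights in \<open>I\<close>.
  Derivatives at \<open>r\<^sub>0\<close> are one-sided. The equation is singular at \<open>r = 0\<close>, and division by zero
  yields 0 in HOL, so it is imposed for \<open>r > 0\<close> only; if \<open>r\<^sub>0 = 0\<close>, the condition at the origin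
  is that \<open>u\<close> is \<open>C\<^sup>2\<close> up to \<open>r = 0\<close> with \<open>u'(0) = 0\<close>.\<close>

definition rotational_minimal_graph ::
    "(real \<Rightarrow> real) \<Rightarrow> real set \<Rightarrow> real \<Rightarrow> real \<Rightarrow> real \<Rightarrow> (real \<Rightarrow> real) \<Rightarrow> bool" where
  "rotational_minimal_graph \<phi> I r0 u0 u1 u \<longleftrightarrow>
    (\<exists>u' u''.
      (\<forall>r\<ge>r0. u r \<in> I
        \<and> (u has_real_derivative u' r) (at r within {r0..})
        \<and> (u' has_real_derivative u'' r) (at r within {r0..})) \<and>
      continuous_on {r0..} u'' \<and>
      (\<forall>r\<ge>r0. r > 0 \<longrightarrow> u'' r = (1 + (u' r)\<^sup>2) * (deriv \<phi> (u r) - u' r / r)) \<and>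
      u r0 = u0 \<and> u' r0 = u1 \<and> (r0 = 0 \<longrightarrow> u1 = 0))"

text \<open>The interval integral is oriented, so this is the primitive of \<open>1/\<phi>'\<close> also for \<open>u < u\<^sub>0\<close>.\<close>

definition primitive_G :: "(real \<Rightarrow> real) \<Rightarrow> real \<Rightarrow> real \<Rightarrow> real" where
  "primitive_G \<phi> u0 u = (LBINT \<xi>=ereal u0..ereal u. 1 / deriv \<phi> \<xi>)"

end

theory Submission
  imports Defs "HOL-Real_Asymp.Real_Asymp"
begin

text \<open>Write \<open>f = \<phi>'\<close> (derivative in the height), \<open>v = u'\<close> and \<open>w = f(u) - v / r\<close>. The profile equation
  \<open>v' = (1 + v\<^sup>2) w\<close> makes \<open>w\<close> satisfy the linear equation
  \<open>w' + (1 + v\<^sup>2) w / r = v (f'(u) + 1 / r\<^sup>2)\<close>, whose damping is strong because \<open>v\<close> grows at least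
  linearly. A barrier argument therefore controls \<open>w\<close>: it is eventually nonnegative, and
  \<open>f(u) w\<close> (if \<open>\<alpha> > 0\<close>), respectively \<open>r\<^sup>2 (r\<^sup>2 w - 1 / \<beta>)\<close> (if \<open>\<alpha> = 0\<close>), stays bounded.

  If \<open>\<alpha> > 0\<close>, then \<open>f\<^sup>2 - 2 \<alpha> \<phi>\<close> grows only logarithmically and \<open>ln u = O(r\<^sup>2)\<close>, so \<open>v = r (f(u) - w)\<close>
  turns \<open>d\<phi>(u)/dr = f(u) v\<close> into \<open>d\<phi>(u)/dr = 2 \<alpha> r \<phi>(u) + O(r\<^sup>3)\<close>; integrate after multiplication by
  \<open>exp (- \<alpha> r\<^sup>2)\<close>. If \<open>\<alpha> = 0\<close>, then \<open>dG(u)/dr = v / f(u) = r - r w / f(u) = r - 1 / (\<beta>\<^sup>2 r) + O(r\<^sup>-\<^sup>3)\<close>.\<close>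

subsection \<open>Barriers and comparison at infinity\<close>

text \<open>If \<open>y x\<close> were negative, let \<open>s\<close> be the last point before
  \<open>x\<close> at which \<open>y\<close> is nonnegative; it exists by closedness. On the
  interval from \<open>s\<close> to \<open>x\<close> the function is negative, hence nondecreasing
  by the barrier condition, so \<open>y x\<close> is at least \<open>y s\<close>. The derivative is
  used only to the right of \<open>a\<close>, so an equation that is singular at the starting point
  is admissible.\<close>

lemma nonneg_if_deriv_nonneg_where_neg:
  fixes y y' :: "real \<Rightarrow> real"
  assumes cont: "continuous_on {a..} y"
    and der: "\<And>x. x > a \<Longrightarrow> (y has_real_derivative y' x) (at x)"
    and start: "y a \<ge> 0"
    and barrier: "\<And>x. x > a \<Longrightarrow> y x < 0 \<Longrightarrow> y' x \<ge> 0"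
    and "x \<ge> a"
  shows "y x \<ge> 0"
proof (rule ccontr)
  assume neg: "\<not> y x \<ge> 0"
  define S where "S = {t \<in> {a..x}. 0 \<le> y t}"
  have "continuous_on {a..x} y"
    by (rule continuous_on_subset[OF cont]) auto
  then have "closed ({a..x} \<inter> y -` {0..})"
    by (rule continuous_closed_preimage) auto
  moreover have "{a..x} \<inter> y -` {0..} = S"
    by (auto simp: S_def)
  ultimately have "closed S"
    by simp
  moreover have "bdd_above S" "S \<noteq> {}"
    unfolding S_def using start \<open>x \<ge> a\<close> by (auto intro!: exI[of _ a] bdd_aboveI[of _ x])
  ultimately have "Sup S \<in> S"
    by (intro closed_contains_Sup)
  define s where "s = Sup S"
  have s: "a \<le> s" "s \<le> x" "0 \<le> y s"
    using \<open>Sup S \<in> S\<close> by (auto simp: s_def S_def)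
  have after: "y t < 0" if "s < t" "t \<le> x" for t
  proof (rule ccontr)
    assume "\<not> y t < 0"
    then have "t \<in> S" using that s by (auto simp: S_def)
    then have "t \<le> s" unfolding s_def using \<open>bdd_above S\<close> by (rule cSup_upper)
    then show False using that by simp
  qed
  have "s < x" using s neg by (cases "s = x") auto
  have "y s \<le> y x"
  proof (rule DERIV_nonneg_imp_increasing_open[of s x y])
    show "s \<le> x" using s by simp
    show "\<exists>d. (y has_real_derivative d) (at t) \<and> 0 \<le> d" if "s < t" "t < x" for t
      using der[of t] barrier[of t] after[of t] that s by auto
    show "continuous_on {s..x} y"
      by (rule continuous_on_subset[OF cont]) (use s in auto)
  qed
  then show False using s neg by simp
qed

text \<open>The level \<open>K\<close> need not dominate the starting value, so the barrier is
  placed at the larger of \<open>K\<close> and \<open>y a\<close>; above it the function cannot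
  rise. All upper bounds on \<open>w\<close> and its rescalings come from this.\<close>

lemma eventually_bounded_above_if_barrier:
  fixes y y' :: "real \<Rightarrow> real"
  assumes der: "\<forall>\<^sub>F x in at_top. (y has_real_derivative y' x) (at x)"
    and barrier: "\<forall>\<^sub>F x in at_top. y x > K \<longrightarrow> y' x \<le> 0"
  shows "\<exists>K. \<forall>\<^sub>F x in at_top. y x \<le> K"
proof -
  obtain a where a: "\<And>x. x \<ge> a \<Longrightarrow> (y has_real_derivative y' x) (at x)"
      "\<And>x. x \<ge> a \<Longrightarrow> y x > K \<Longrightarrow> y' x \<le> 0"
    using eventually_conj[OF der barrier] by (auto simp: eventually_at_top_linorder)
  define K' where "K' = max K (y a)"
  have "K' - y x \<ge> 0" if "x \<ge> a" for x
  proof (rule nonneg_if_deriv_nonneg_where_neg[of a "\<lambda>x. K' - y x" "\<lambda>x. - y' x"])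
    show "continuous_on {a..} (\<lambda>x. K' - y x)"
      by (intro continuous_intros continuous_at_imp_continuous_on) (auto intro: DERIV_isCont a)
    show "((\<lambda>x. K' - y x) has_real_derivative - y' x) (at x)" if "x > a" for x
      using a(1)[of x] that by (auto intro!: derivative_eq_intros)
    show "0 \<le> - y' x" if "x > a" "K' - y x < 0" for x
      using a(2)[of x] that by (auto simp: K'_def)
  qed (use that in \<open>auto simp: K'_def\<close>)
  then show ?thesis
    by (intro exI[of _ K'] eventually_at_top_linorderI[of a]) simp
qed

lemma eventually_le_if_deriv_le:
  fixes y y' k k' :: "real \<Rightarrow> real"
  assumes "\<forall>\<^sub>F x in at_top. (y has_real_derivative y' x) (at x)"
    and "\<forall>\<^sub>F x in at_top. (k has_real_derivative k' x) (at x)"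
    and "\<forall>\<^sub>F x in at_top. y' x \<le> k' x"
  shows "\<exists>C. \<forall>\<^sub>F x in at_top. y x \<le> k x + C"
proof -
  have "\<exists>C. \<forall>\<^sub>F x in at_top. y x - k x \<le> C"
  proof (rule eventually_bounded_above_if_barrier[where y' = "\<lambda>x. y' x - k' x" and K = 0])
    show "\<forall>\<^sub>F x in at_top. ((\<lambda>x. y x - k x) has_real_derivative y' x - k' x) (at x)"
      using assms(1,2) by eventually_elim (rule DERIV_diff)
    show "\<forall>\<^sub>F x in at_top. y x - k x > 0 \<longrightarrow> y' x - k' x \<le> 0"
      using assms(3) by eventually_elim simp
  qed
  then show ?thesis by (simp add: algebra_simps)
qed

text \<open>The integral of \<open>\<kappa> / x\<close> diverges: a function that stayed negative
  would outgrow \<open>\<kappa> * ln x\<close> up to a constant, a contradiction. Once nonnegative,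
  it stays so by the barrier principle.\<close>

lemma eventually_nonneg_if_growing_where_neg:
  fixes y y' :: "real \<Rightarrow> real"
  assumes der: "\<forall>\<^sub>F x in at_top. (y has_real_derivative y' x) (at x)"
    and barrier: "\<forall>\<^sub>F x in at_top. y x < 0 \<longrightarrow> y' x \<ge> \<kappa> / x"
    and "\<kappa> > 0"
  shows "\<forall>\<^sub>F x in at_top. y x \<ge> 0"
proof -
  obtain a where a: "a \<ge> 1" "\<And>x. x \<ge> a \<Longrightarrow> (y has_real_derivative y' x) (at x)"
      "\<And>x. x \<ge> a \<Longrightarrow> y x < 0 \<Longrightarrow> y' x \<ge> \<kappa> / x"
    using eventually_conj[OF eventually_ge_at_top[of 1] eventually_conj[OF der barrier]]
    unfolding eventually_at_top_linorder by (metis order.refl order.trans)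
  have "\<exists>b\<ge>a. y b \<ge> 0"
  proof (rule ccontr)
    assume "\<not> ?thesis"
    then have neg: "y x < 0" if "x \<ge> a" for x using that by force
    have "\<exists>C. \<forall>\<^sub>F x in at_top. \<kappa> * ln x \<le> y x + C"
    proof (rule eventually_le_if_deriv_le)
      show "\<forall>\<^sub>F x in at_top. ((\<lambda>x. \<kappa> * ln x) has_real_derivative \<kappa> / x) (at x)"
        using eventually_gt_at_top[of 0] by eventually_elim (auto intro!: derivative_eq_intros)
      show "\<forall>\<^sub>F x in at_top. \<kappa> / x \<le> y' x"
        using eventually_ge_at_top[of a] by eventually_elim (simp add: a neg)
    qed (fact der)
    then obtain C where "\<forall>\<^sub>F x in at_top. \<kappa> * ln x \<le> y x + C" by blast
    moreover have "\<forall>\<^sub>F x in at_top. \<kappa> * ln x > C"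
      using \<open>\<kappa> > 0\<close> by real_asymp
    ultimately have "\<forall>\<^sub>F x::real in at_top. False"
      using eventually_ge_at_top[of a] by eventually_elim (use neg in force)
    then show False by simp
  qed
  then obtain b where b: "b \<ge> a" "y b \<ge> 0" by blast
  have "y x \<ge> 0" if "x \<ge> b" for x
  proof (rule nonneg_if_deriv_nonneg_where_neg[of b y y'])
    show "continuous_on {b..} y"
      by (intro continuous_at_imp_continuous_on) (use b in \<open>force intro: DERIV_isCont a(2)\<close>)
    show "0 \<le> y' x" if "x > b" "y x < 0" for x
    proof -
      have "0 \<le> \<kappa> / x" using a(1) b that \<open>\<kappa> > 0\<close> by simp
      then show ?thesis using a(3)[of x] b that by simp
    qed
  qed (use b a that in auto)
  then show ?thesis
    by (rule eventually_at_top_linorderI)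
qed

text \<open>A tail estimate without integrals, in which \<open>k\<close> plays the part of the
  integral of the bound from \<open>x\<close> to infinity. Since \<open>y - k\<close> is
  nondecreasing and \<open>y + k\<close> nonincreasing, the intervals between them are nested, and
  \<open>L\<close> is the supremum of their left endpoints.\<close>

lemma converges_if_deriv_bounded:
  fixes y y' k k' :: "real \<Rightarrow> real"
  assumes "\<forall>\<^sub>F x in at_top. (y has_real_derivative y' x) (at x)"
    and "\<forall>\<^sub>F x in at_top. (k has_real_derivative k' x) (at x)"
    and "\<forall>\<^sub>F x in at_top. \<bar>y' x\<bar> \<le> - k' x"
    and "\<forall>\<^sub>F x in at_top. k x \<ge> 0"
  shows "\<exists>L. \<forall>\<^sub>F x in at_top. \<bar>y x - L\<bar> \<le> k x"
proof -
  obtain a where der: "\<And>x. x \<ge> a \<Longrightarrow> (y has_real_derivative y' x) (at x)"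
      "\<And>x. x \<ge> a \<Longrightarrow> (k has_real_derivative k' x) (at x)"
    and bnd: "\<And>x. x \<ge> a \<Longrightarrow> \<bar>y' x\<bar> \<le> - k' x" "\<And>x. x \<ge> a \<Longrightarrow> k x \<ge> 0"
    using eventually_conj[OF eventually_conj[OF assms(1,2)] eventually_conj[OF assms(3,4)]]
    unfolding eventually_at_top_linorder by blast
  have lower: "y s - k s \<le> y t - k t" if "a \<le> s" "s \<le> t" for s t
  proof (rule DERIV_nonneg_imp_nondecreasing[of s t "\<lambda>x. y x - k x"])
    show "\<exists>d. ((\<lambda>x. y x - k x) has_real_derivative d) (at x) \<and> 0 \<le> d" if "s \<le> x" "x \<le> t" for x
      using DERIV_diff[OF der(1)[of x] der(2)[of x]] bnd(1)[of x] that \<open>a \<le> s\<close>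
      by (intro exI[of _ "y' x - k' x"]) auto
  qed (fact that)
  have upper: "y t + k t \<le> y s + k s" if "a \<le> s" "s \<le> t" for s t
  proof (rule DERIV_nonpos_imp_nonincreasing[of s t "\<lambda>x. y x + k x"])
    show "\<exists>d. ((\<lambda>x. y x + k x) has_real_derivative d) (at x) \<and> d \<le> 0" if "s \<le> x" "x \<le> t" for x
      using DERIV_add[OF der(1)[of x] der(2)[of x]] bnd(1)[of x] that \<open>a \<le> s\<close>
      by (intro exI[of _ "y' x + k' x"]) auto
  qed (fact that)
  have cross: "y s - k s \<le> y t + k t" if "a \<le> s" "a \<le> t" for s t
    using lower[of s "max s t"] upper[of t "max s t"] bnd(2)[of "max s t"] that by linarith
  define L where "L = (SUP s\<in>{a..}. y s - k s)"
  have "y x - k x \<le> L" "L \<le> y x + k x" if "x \<ge> a" for x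
    unfolding L_def using that cross
    by (auto intro!: cSUP_upper cSUP_least bdd_aboveI[of _ "y a + k a"])
  then show ?thesis
    by (intro exI[of _ L] eventually_at_top_linorderI[of a]) (force simp: abs_le_iff)
qed

subsection \<open>The behaviour of the potential at large heights\<close>

text \<open>In the variable \<open>t = 1 / x\<close> the expansion is a power series
  \<open>g\<close> without constant term. It converges at \<open>1 / X\<close>, hence is
  differentiable inside that radius. Thus \<open>g t / t\<close> and \<open>g' t\<close> are bounded
  near 0, and the chain rule turns this into the two estimates at infinity.\<close>

lemma asymptotics_of_series_in_inverse:
  fixes f :: "real \<Rightarrow> real"
  assumes "\<forall>\<^sub>F x in at_top. (\<lambda>n. c (Suc n) / x ^ Suc n) sums (f x - (\<alpha> * x + \<beta>))"
  shows "\<exists>M. \<forall>\<^sub>F x in at_top. \<bar>f x - (\<alpha> * x + \<beta>)\<bar> \<le> M / x \<and> \<bar>deriv f x - \<alpha>\<bar> \<le> M / x\<^sup>2"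
proof -
  \<comment> \<open>The value \<open>c 0\<close> is unconstrained, so the constant coefficient is
    set to 0 explicitly.\<close>
  define b where "b n = (if n = 0 then 0 else c n)" for n
  define g where "g t = (\<Sum>n. b n * t ^ n)" for t
  obtain X where X: "X > 0" "\<And>x. x \<ge> X \<Longrightarrow>
      (\<lambda>n. c (Suc n) / x ^ Suc n) sums (f x - (\<alpha> * x + \<beta>))"
    using eventually_conj[OF eventually_gt_at_top[of 0] assms]
    unfolding eventually_at_top_linorder by (metis order.refl order.trans)
  have sums: "(\<lambda>n. b n * (1 / x) ^ n) sums (f x - (\<alpha> * x + \<beta>))" if "x \<ge> X" for x
  proof -
    have "(\<lambda>n. b (Suc n) * (1 / x) ^ Suc n) sums (f x - (\<alpha> * x + \<beta>))"
      using X(2)[OF that] by (simp add: b_def power_one_over divide_inverse power_inverse)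
    from sums_Suc[OF this] show ?thesis
      by (simp add: b_def)
  qed
  have f_eq: "f x = \<alpha> * x + \<beta> + g (1 / x)" if "x \<ge> X" for x
    using sums_unique[OF sums[OF that]] by (simp add: g_def)
  define g' where "g' t = (\<Sum>n. diffs b n * t ^ n)" for t
  have summable: "summable (\<lambda>n. b n * t ^ n)" if "\<bar>t\<bar> < 1 / X" for t
    by (rule powser_inside[of _ "1 / X"]) (use sums[of X] that X(1) in \<open>auto simp: sums_iff\<close>)
  have der: "(g has_real_derivative g' t) (at t)" if "\<bar>t\<bar> < 1 / X" for t
    unfolding g_def g'_def using termdiffs_strong'[OF summable, of "1 / X" t] that by simp
  \<comment> \<open>Half the radius suffices: only continuity of \<open>g'\<close> at 0 is wanted,
    and this requires convergence of the differentiated series at some nonzero point.\<close>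
  have "summable (\<lambda>n. diffs b n * (1 / (2 * X)) ^ n)"
    by (rule termdiff_converges[of _ "1 / X", OF _ summable]) (use X(1) in \<open>auto simp: field_simps\<close>)
  then have "isCont g' 0"
    unfolding g'_def by (rule isCont_powser) (use X(1) in auto)
  have g_0: "g 0 = 0"
    by (simp add: g_def b_def)
  have der_f: "(f has_real_derivative \<alpha> - g' (1 / x) / x\<^sup>2) (at x)" if "x > X" for x
  proof (rule has_field_derivative_transform_within_open[of _ _ _ "{X<..}"])
    show "((\<lambda>x. \<alpha> * x + \<beta> + g (1 / x)) has_real_derivative \<alpha> - g' (1 / x) / x\<^sup>2) (at x)"
      using that X(1)
      by (auto intro!: derivative_eq_intros DERIV_chain2[OF der] simp: field_simps power2_eq_square)
  qed (use that f_eq in auto)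
  define M where "M = \<bar>g' 0\<bar> + 1"
  have inv_lim: "filterlim (\<lambda>x::real. 1 / x) (at 0) at_top"
    by real_asymp
  have "((\<lambda>t. \<bar>g t / t\<bar>) \<longlongrightarrow> \<bar>g' 0\<bar>) (at 0)"
    using der[of 0] X(1) g_0 by (intro tendsto_intros) (simp add: DERIV_def)
  then have "\<forall>\<^sub>F t in at 0. \<bar>g t / t\<bar> < M"
    by (rule order_tendstoD) (simp add: M_def)
  moreover have "((\<lambda>t. \<bar>g' t\<bar>) \<longlongrightarrow> \<bar>g' 0\<bar>) (at 0)"
    using \<open>isCont g' 0\<close> by (intro tendsto_intros) (simp add: isCont_def)
  then have "\<forall>\<^sub>F t in at 0. \<bar>g' t\<bar> < M"
    by (rule order_tendstoD) (simp add: M_def)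
  ultimately have "\<forall>\<^sub>F t in at 0. \<bar>g t / t\<bar> < M \<and> \<bar>g' t\<bar> < M"
    by (rule eventually_conj)
  from eventually_compose_filterlim[OF this inv_lim]
  have "\<forall>\<^sub>F x in at_top. \<bar>f x - (\<alpha> * x + \<beta>)\<bar> \<le> M / x \<and> \<bar>deriv f x - \<alpha>\<bar> \<le> M / x\<^sup>2"
    using eventually_gt_at_top[of X]
  proof eventually_elim
    case (elim x)
    then have "x > 0" using X(1) by simp
    have "f x - (\<alpha> * x + \<beta>) = g (1 / x)"
      using f_eq[of x] elim by simp
    moreover have "deriv f x - \<alpha> = - (g' (1 / x) / x\<^sup>2)"
      using DERIV_imp_deriv[OF der_f[of x]] elim by simp
    moreover have "\<bar>g (1 / x)\<bar> \<le> M / x" "\<bar>g' (1 / x) / x\<^sup>2\<bar> \<le> M / x\<^sup>2"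
      using elim \<open>x > 0\<close> by (auto simp: abs_mult field_simps)
    ultimately show ?case
      by (simp only: abs_minus_cancel)
  qed
  then show ?thesis by blast
qed

text \<open>The derivative of \<open>f\<^sup>2 - 2 * \<alpha> * \<phi>\<close> is
  \<open>2 * f * (f' - \<alpha>)\<close>, a product of a factor of order \<open>x\<close> and one of
  order \<open>1 / x\<^sup>2\<close>. Its primitive is therefore at most logarithmic.\<close>

lemma ln_growth_if_deriv_near_linear:
  fixes f f' \<phi> :: "real \<Rightarrow> real"
  assumes der_\<phi>: "\<forall>\<^sub>F x in at_top. (\<phi> has_real_derivative f x) (at x)"
    and der_f: "\<forall>\<^sub>F x in at_top. (f has_real_derivative f' x) (at x)"
    and f_le: "\<forall>\<^sub>F x in at_top. \<bar>f x\<bar> \<le> B * x"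
    and f'_lim: "\<forall>\<^sub>F x in at_top. \<bar>f' x - \<alpha>\<bar> \<le> M / x\<^sup>2"
  shows "\<exists>A\<ge>0. \<forall>\<^sub>F x in at_top. \<bar>(f x)\<^sup>2 - 2 * \<alpha> * \<phi> x\<bar> \<le> A * ln x"
proof -
  let ?h = "\<lambda>x. (f x)\<^sup>2 - 2 * \<alpha> * \<phi> x"
  let ?h' = "\<lambda>x. 2 * f x * (f' x - \<alpha>)"
  define A where "A = 2 * \<bar>B * M\<bar>"
  have der_h: "\<forall>\<^sub>F x in at_top. (?h has_real_derivative ?h' x) (at x)"
    using der_\<phi> der_f by eventually_elim (auto intro!: derivative_eq_intros simp: algebra_simps)
  have der_ln: "\<forall>\<^sub>F x in at_top. ((\<lambda>x. A * ln x) has_real_derivative A / x) (at x)"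
    using eventually_gt_at_top[of 0] by eventually_elim (auto intro!: derivative_eq_intros)
  have le: "\<forall>\<^sub>F x in at_top. \<bar>?h' x\<bar> \<le> A / x"
    using f_le f'_lim eventually_gt_at_top[of 0]
  proof eventually_elim
    case (elim x)
    have "\<bar>f x\<bar> * \<bar>f' x - \<alpha>\<bar> \<le> (B * x) * (M / x\<^sup>2)"
      using elim by (intro mult_mono) auto
    also have "\<dots> = B * M / x"
      by (simp add: power2_eq_square)
    also have "\<dots> \<le> \<bar>B * M\<bar> / x"
      using elim by (intro divide_right_mono) auto
    finally show ?case by (simp add: A_def abs_mult)
  qed
  have "\<exists>C. \<forall>\<^sub>F x in at_top. ?h x \<le> A * ln x + C"
    by (rule eventually_le_if_deriv_le[OF der_h der_ln]) (use le in eventually_elim, simp)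
  moreover have "\<exists>C. \<forall>\<^sub>F x in at_top. - ?h x \<le> A * ln x + C"
  proof (rule eventually_le_if_deriv_le[OF _ der_ln])
    show "\<forall>\<^sub>F x in at_top. ((\<lambda>x. - ?h x) has_real_derivative - ?h' x) (at x)"
      using der_h by eventually_elim (rule DERIV_minus)
  qed (use le in eventually_elim, simp)
  ultimately obtain C1 C2 where "\<forall>\<^sub>F x in at_top. ?h x \<le> A * ln x + C1"
      "\<forall>\<^sub>F x in at_top. - ?h x \<le> A * ln x + C2"
    by blast
  \<comment> \<open>The integration constants are absorbed by raising the coefficient of the
    logarithm by 1.\<close>
  moreover have "\<forall>\<^sub>F x::real in at_top. ln x \<ge> max C1 C2"
    using ln_at_top unfolding filterlim_at_top by blast
  ultimately have "\<forall>\<^sub>F x in at_top. \<bar>?h x\<bar> \<le> (A + 1) * ln x"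
    by eventually_elim (auto simp: distrib_right abs_le_iff)
  moreover have "A + 1 \<ge> 0" by (simp add: A_def)
  ultimately show ?thesis by blast
qed

subsection \<open>The profile equation\<close>

text \<open>Every condition on the profile is imposed for large \<open>r\<close> only, so the
  initial data and a possible singularity at the origin are left behind. What survives of them is
  the linear lower bound on \<open>v\<close>.\<close>

locale radial_profile =
  fixes f f' u v :: "real \<Rightarrow> real" and \<kappa> :: real
  assumes deriv_u: "\<forall>\<^sub>F r in at_top. (u has_real_derivative v r) (at r)"
    and deriv_v: "\<forall>\<^sub>F r in at_top.
      (v has_real_derivative (1 + (v r)\<^sup>2) * (f (u r) - v r / r)) (at r)"
    and deriv_f: "\<forall>\<^sub>F r in at_top. (f has_real_derivative f' (u r)) (at (u r))"
    and f'_nonneg: "\<forall>\<^sub>F r in at_top. f' (u r) \<ge> 0"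
    and \<kappa>_pos: "\<kappa> > 0"
    and v_lower: "\<forall>\<^sub>F r in at_top. v r \<ge> \<kappa> * r"
begin

section \<open>The defect \<open>w\<close>: its equation and a priori bounds\<close>

definition w :: "real \<Rightarrow> real" where
  "w r = f (u r) - v r / r"

lemma v_eq: "r \<noteq> 0 \<Longrightarrow> v r = r * (f (u r) - w r)"
  by (simp add: w_def)

lemma v_nonneg: "\<forall>\<^sub>F r in at_top. v r \<ge> 0"
  using v_lower eventually_ge_at_top[of 0]
proof eventually_elim
  case (elim r)
  have "0 \<le> \<kappa> * r" using elim \<kappa>_pos by simp
  then show ?case using elim(1) by (rule order.trans)
qed

lemma deriv_w:
  "\<forall>\<^sub>F r in at_top. (w has_real_derivative
     v r * (f' (u r) + 1 / r\<^sup>2) - (1 + (v r)\<^sup>2) * w r / r) (at r)"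
  using deriv_u deriv_v deriv_f eventually_gt_at_top[of 0]
proof eventually_elim
  case (elim r)
  have "((\<lambda>r. f (u r)) has_real_derivative f' (u r) * v r) (at r)"
    using elim by (intro DERIV_chain2) auto
  then show ?case
    unfolding w_def using elim
    by (auto intro!: derivative_eq_intros simp: field_simps power2_eq_square)
qed

text \<open>Integrating \<open>v r \<ge> \<kappa> * r\<close> gives the coefficient
  \<open>\<kappa> / 2\<close> up to a constant; halving the coefficient absorbs the
  constant.\<close>

lemma u_lower: "\<forall>\<^sub>F r in at_top. u r \<ge> \<kappa> / 4 * r\<^sup>2"
proof -
  have "\<exists>C. \<forall>\<^sub>F r in at_top. \<kappa> / 2 * r\<^sup>2 \<le> u r + C"
  proof (rule eventually_le_if_deriv_le)
    show "\<forall>\<^sub>F r in at_top. ((\<lambda>r. \<kappa> / 2 * r\<^sup>2) has_real_derivative \<kappa> * r) (at r)"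
      by (intro always_eventually allI) (auto intro!: derivative_eq_intros)
  qed (fact deriv_u v_lower)+
  then obtain C where "\<forall>\<^sub>F r in at_top. \<kappa> / 2 * r\<^sup>2 \<le> u r + C" ..
  moreover have "\<forall>\<^sub>F r in at_top. C \<le> \<kappa> / 4 * r\<^sup>2"
    using \<kappa>_pos by real_asymp
  ultimately show ?thesis by eventually_elim simp
qed

lemma u_at_top: "filterlim u at_top at_top"
proof (rule filterlim_at_top_mono[OF _ u_lower])
  show "filterlim (\<lambda>r. \<kappa> / 4 * r\<^sup>2) at_top at_top"
    using \<kappa>_pos by real_asymp
qed

text \<open>Where \<open>w\<close> is negative the damping term pushes it upwards, and the source is
  at least \<open>v / r\<^sup>2\<close>, hence at least \<open>\<kappa> / r\<close>. This is exactly
  the non-integrable rate that the growth criterion needs.\<close>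

lemma w_nonneg: "\<forall>\<^sub>F r in at_top. w r \<ge> 0"
proof (rule eventually_nonneg_if_growing_where_neg[OF deriv_w _ \<kappa>_pos])
  show "\<forall>\<^sub>F r in at_top. w r < 0 \<longrightarrow>
      v r * (f' (u r) + 1 / r\<^sup>2) - (1 + (v r)\<^sup>2) * w r / r \<ge> \<kappa> / r"
    using v_lower v_nonneg f'_nonneg eventually_gt_at_top[of 0]
  proof eventually_elim
    case (elim r)
    have "\<kappa> / r = (\<kappa> * r) * (0 + 1 / r\<^sup>2)"
      using elim by (simp add: power2_eq_square)
    also have "\<dots> \<le> v r * (f' (u r) + 1 / r\<^sup>2)"
      using elim \<kappa>_pos by (intro mult_mono) auto
    finally have source: "\<kappa> / r \<le> v r * (f' (u r) + 1 / r\<^sup>2)" .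
    show ?case
    proof
      assume "w r < 0"
      then have "(1 + (v r)\<^sup>2) * w r / r \<le> 0"
        using elim by (intro divide_nonpos_pos mult_nonneg_nonpos) auto
      with source show "v r * (f' (u r) + 1 / r\<^sup>2) - (1 + (v r)\<^sup>2) * w r / r \<ge> \<kappa> / r"
        by simp
    qed
  qed
qed

text \<open>For \<open>r \<ge> 1\<close> the source is at most \<open>(L + 1) * v\<close>, while
  \<open>v / r \<ge> \<kappa>\<close> makes the damping at least \<open>\<kappa> * v * w\<close>.
  The damping wins as soon as \<open>w\<close> exceeds \<open>(L + 1) / \<kappa>\<close>.\<close>

lemma w_bounded:
  assumes "\<forall>\<^sub>F r in at_top. f' (u r) \<le> L"
  shows "\<exists>K. \<forall>\<^sub>F r in at_top. w r \<le> K"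
proof (rule eventually_bounded_above_if_barrier[OF deriv_w])
  show "\<forall>\<^sub>F r in at_top. w r > (L + 1) / \<kappa> \<longrightarrow>
      v r * (f' (u r) + 1 / r\<^sup>2) - (1 + (v r)\<^sup>2) * w r / r \<le> 0"
    using v_lower v_nonneg f'_nonneg w_nonneg assms eventually_ge_at_top[of 1]
  proof eventually_elim
    case (elim r)
    then have "v r \<ge> 0" by simp
    show ?case
    proof
      assume "w r > (L + 1) / \<kappa>"
      then have "L + 1 \<le> \<kappa> * w r" using \<kappa>_pos by (simp add: field_simps)
      have "v r * (f' (u r) + 1 / r\<^sup>2) \<le> v r * (L + 1)"
        using elim \<open>v r \<ge> 0\<close> by (intro mult_left_mono add_mono) auto
      also have "\<dots> \<le> v r * (\<kappa> * w r)"
        using \<open>L + 1 \<le> \<kappa> * w r\<close> \<open>v r \<ge> 0\<close> by (rule mult_left_mono)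
      also have "\<dots> \<le> v r * (v r / r * w r)"
        using elim \<open>v r \<ge> 0\<close> by (intro mult_left_mono mult_right_mono) (auto simp: field_simps)
      also have "\<dots> \<le> (1 + (v r)\<^sup>2) * w r / r"
        using elim by (simp add: field_simps power2_eq_square)
      finally show "v r * (f' (u r) + 1 / r\<^sup>2) - (1 + (v r)\<^sup>2) * w r / r \<le> 0"
        by simp
    qed
  qed
qed

text \<open>Mere boundedness of \<open>w\<close> is sharpened by using the true size of the damping:
  \<open>v / r = f - w\<close> is at least \<open>f / 2\<close> once \<open>f\<close> is large. In
  the equation for \<open>f * w\<close> the damping is then at least
  \<open>v * (f * w) * (f / 2)\<close>, against source terms of size at most
  \<open>L' * v * (w + f)\<close>.\<close>

lemma w_f_bounded:
  assumes "\<forall>\<^sub>F r in at_top. f' (u r) \<le> L" and "filterlim (\<lambda>r. f (u r)) at_top at_top"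
  shows "\<exists>K. \<forall>\<^sub>F r in at_top. f (u r) * w r \<le> K"
proof (rule eventually_bounded_above_if_barrier)
  let ?w' = "\<lambda>r. v r * (f' (u r) + 1 / r\<^sup>2) - (1 + (v r)\<^sup>2) * w r / r"
  let ?q' = "\<lambda>r. f' (u r) * v r * w r + f (u r) * ?w' r"
  show "\<forall>\<^sub>F r in at_top. ((\<lambda>r. f (u r) * w r) has_real_derivative ?q' r) (at r)"
    using deriv_u deriv_f deriv_w
  proof eventually_elim
    case (elim r)
    have "((\<lambda>r. f (u r)) has_real_derivative f' (u r) * v r) (at r)"
      using elim by (intro DERIV_chain2) auto
    from DERIV_mult[OF this elim(3)] show ?case by (simp add: algebra_simps)
  qed
  \<comment> \<open>For \<open>r \<ge> 1\<close> this one constant bounds both \<open>f'\<close> and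
    \<open>f' + 1 / r\<^sup>2\<close>, and it is at least 1.\<close>
  define L' where "L' = max L 0 + 1"
  obtain K where "\<forall>\<^sub>F r in at_top. w r \<le> K"
    using w_bounded[OF assms(1)] by blast
  \<comment> \<open>The threshold \<open>2 * K\<close> gives \<open>w \<le> f / 2\<close>. The
    threshold \<open>2 * L' + 1\<close> makes \<open>f\<close> at least 3 and at least
    \<open>2 * L'\<close>, so that the term \<open>L' * w\<close> is dominated too.\<close>
  moreover have "\<forall>\<^sub>F r in at_top. f (u r) \<ge> max (2 * K) (2 * L' + 1)"
    using assms(2) unfolding filterlim_at_top by blast
  ultimately show "\<forall>\<^sub>F r in at_top. f (u r) * w r > 4 * L' \<longrightarrow> ?q' r \<le> 0"
    using assms(1) w_nonneg v_nonneg f'_nonneg eventually_ge_at_top[of 1]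
  proof eventually_elim
    case (elim r)
    define F W V where "F = f (u r)" and "W = w r" and "V = v r"
    have "V \<ge> 0" using elim by (simp add: V_def)
    have L': "L' \<ge> 1" by (simp add: L'_def)
    have F: "F \<ge> 2 * K" "F \<ge> 2 * L' + 1" and W: "0 \<le> W" "W \<le> K"
      using elim by (auto simp: F_def W_def)
    have V: "V / r = F - W"
      using elim by (simp add: V_def F_def W_def w_def)
    show ?case
    proof
      assume "f (u r) * w r > 4 * L'"
      then have q: "F * W > 4 * L'" by (simp add: F_def W_def)
      have 1: "f' (u r) * V * W \<le> V * (L' * W)"
      proof -
        have "f' (u r) * (V * W) \<le> L' * (V * W)"
          using elim \<open>V \<ge> 0\<close> W by (intro mult_right_mono) (auto simp: L'_def)
        then show ?thesis by (simp add: mult_ac)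
      qed
      have 2: "F * (V * (f' (u r) + 1 / r\<^sup>2)) \<le> V * (F * L')"
      proof -
        have "F * V * (f' (u r) + 1 / r\<^sup>2) \<le> F * V * L'"
          using elim \<open>V \<ge> 0\<close> F L' unfolding L'_def
          by (intro mult_left_mono add_mono) (auto simp: max_def)
        then show ?thesis by (simp add: mult_ac)
      qed
      have 3: "V * (F * W * (F / 2)) \<le> F * ((1 + V\<^sup>2) * W / r)"
      proof -
        have "F * W * V * (F / 2) \<le> F * W * V * (V / r)"
          using F W \<open>V \<ge> 0\<close> L' V by (intro mult_left_mono) auto
        also have "\<dots> \<le> F * W * V * (V / r) + F * W / r"
          using F W L' elim by simp
        also have "\<dots> = F * ((1 + V\<^sup>2) * W / r)"
          using elim by (simp add: field_simps power2_eq_square)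
        finally show ?thesis by (simp add: mult_ac)
      qed
      have "L' * W + F * L' \<le> F * W * (F / 2)"
      proof -
        have "F * L' * 4 \<le> F * (F * W)"
          using q F L' by (subst mult.assoc, intro mult_left_mono) auto
        moreover have "4 * (L' * W) \<le> F * (F * W)"
        proof -
          have "(2 * L') * (2 * W) \<le> F * (F * W)"
            using F L' W by (intro mult_mono) (auto intro!: mult_right_mono)
          then show ?thesis by simp
        qed
        ultimately show ?thesis by (simp add: field_simps)
      qed
      then have "V * (L' * W + F * L') \<le> V * (F * W * (F / 2))"
        using \<open>V \<ge> 0\<close> by (rule mult_left_mono)
      with 1 2 3 show "?q' r \<le> 0"
        unfolding F_def[symmetric] W_def[symmetric] V_def[symmetric]
        by (simp add: right_diff_distrib distrib_left)
    qed
  qed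
qed

section \<open>The case in which \<open>f\<close> tends to a constant\<close>

text \<open>With \<open>p = r\<^sup>2 * w\<close>, the damping in the equation for \<open>p\<close>
  is at least \<open>\<kappa> * v * p\<close>. Half of it pays for the source, at most
  \<open>2 * v\<close> once \<open>r\<^sup>2 \<ge> M\<close>, because
  \<open>\<kappa> * p \<ge> 4\<close> above the barrier. The other half pays for
  \<open>2 * r * w\<close>, the term from differentiating the weight, because
  \<open>v \<ge> \<kappa> * r\<close> and
  \<open>\<kappa>\<^sup>2 * r\<^sup>2 \<ge> 4\<close>.\<close>

lemma r2_w_bounded:
  assumes f'_le: "\<forall>\<^sub>F r in at_top. f' (u r) \<le> M / r ^ 4"
  shows "\<exists>K. \<forall>\<^sub>F r in at_top. r\<^sup>2 * w r \<le> K"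
proof (rule eventually_bounded_above_if_barrier)
  let ?w' = "\<lambda>r. v r * (f' (u r) + 1 / r\<^sup>2) - (1 + (v r)\<^sup>2) * w r / r"
  let ?p' = "\<lambda>r. 2 * r * w r + r\<^sup>2 * ?w' r"
  show "\<forall>\<^sub>F r in at_top. ((\<lambda>r. r\<^sup>2 * w r) has_real_derivative ?p' r) (at r)"
    using deriv_w by eventually_elim (auto intro!: derivative_eq_intros)
  have "\<forall>\<^sub>F r in at_top. \<kappa>\<^sup>2 * r\<^sup>2 \<ge> 4" "\<forall>\<^sub>F r in at_top. r\<^sup>2 \<ge> M"
    using \<kappa>_pos by real_asymp+
  then show "\<forall>\<^sub>F r in at_top. r\<^sup>2 * w r > 4 / \<kappa> \<longrightarrow> ?p' r \<le> 0"
    using f'_le w_nonneg v_nonneg v_lower f'_nonneg eventually_ge_at_top[of 1]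
  proof eventually_elim
    case (elim r)
    define V W where "V = v r" and "W = w r"
    have V: "V \<ge> 0" "V / r \<ge> \<kappa>" and W: "W \<ge> 0"
      using elim by (auto simp: V_def W_def field_simps)
    have r: "r \<ge> 1" using elim by simp
    show ?case
    proof
      assume "r\<^sup>2 * w r > 4 / \<kappa>"
      then have p: "r\<^sup>2 * W * \<kappa> \<ge> 4" using \<kappa>_pos by (simp add: W_def field_simps)
      have 1: "r\<^sup>2 * (V * (f' (u r) + 1 / r\<^sup>2)) \<le> 2 * V"
      proof -
        have "f' (u r) * r\<^sup>2 \<le> M / r ^ 4 * r\<^sup>2"
          using elim by (intro mult_right_mono) auto
        also have "\<dots> = M / r\<^sup>2"
          using r by (simp add: power2_eq_square power4_eq_xxxx)
        also have "\<dots> \<le> 1"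
          using elim r by simp
        finally have "V * (f' (u r) * r\<^sup>2 + 1) \<le> V * 2"
          using V by (intro mult_left_mono) auto
        moreover have "r\<^sup>2 * (f' (u r) + 1 / r\<^sup>2) = f' (u r) * r\<^sup>2 + 1"
          using r by (simp add: distrib_left mult.commute)
        ultimately show ?thesis by (simp add: mult.left_commute[of _ V])
      qed
      have "V * (\<kappa> * (r\<^sup>2 * W)) \<le> V * (V / r * (r\<^sup>2 * W))"
        using V W by (intro mult_left_mono mult_right_mono) auto
      also have "\<dots> = r\<^sup>2 * (V\<^sup>2 * W / r)"
        using r by (simp add: field_simps power2_eq_square)
      also have "\<dots> \<le> r\<^sup>2 * ((1 + V\<^sup>2) * W / r)"
        using W r by (intro mult_left_mono divide_right_mono mult_right_mono) auto
      finally have 2: "V * (\<kappa> * (r\<^sup>2 * W)) \<le> r\<^sup>2 * ((1 + V\<^sup>2) * W / r)" .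
      have 3: "4 * r * W \<le> V * (\<kappa> * (r\<^sup>2 * W))"
      proof -
        have "4 * (r * W) \<le> (\<kappa>\<^sup>2 * r\<^sup>2) * (r * W)"
          using elim W r by (intro mult_right_mono) auto
        also have "\<dots> = \<kappa> * r * (\<kappa> * (r\<^sup>2 * W))"
          by (simp add: power2_eq_square)
        also have "\<dots> \<le> V * (\<kappa> * (r\<^sup>2 * W))"
          using elim W \<kappa>_pos by (intro mult_right_mono) (auto simp: V_def)
        finally show ?thesis by simp
      qed
      have 4: "4 * V \<le> V * (\<kappa> * (r\<^sup>2 * W))"
        using mult_left_mono[OF p V(1)] by (simp add: mult_ac)
      have "?p' r = 2 * r * W + r\<^sup>2 * (V * (f' (u r) + 1 / r\<^sup>2)) - r\<^sup>2 * ((1 + V\<^sup>2) * W / r)"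
        by (simp add: V_def W_def right_diff_distrib)
      with 1 2 3 4 show "?p' r \<le> 0" by linarith
    qed
  qed
qed

text \<open>In the quasi-stationary state, \<open>r\<^sup>2 w \<approx> 1 / \<beta>\<close>; this is the origin of the logarithmic term.\<close>

lemma r2_w_asymptotics:
  assumes f'_le: "\<forall>\<^sub>F r in at_top. f' (u r) \<le> M / r ^ 4"
    and f_lim: "\<forall>\<^sub>F r in at_top. \<bar>f (u r) - \<beta>\<bar> \<le> M / r\<^sup>2"
    and "\<beta> > 0"
  shows "\<exists>K. \<forall>\<^sub>F r in at_top. \<bar>r\<^sup>2 * (r\<^sup>2 * w r - 1 / \<beta>)\<bar> \<le> K"
proof -
  obtain P where P: "\<forall>\<^sub>F r in at_top. r\<^sup>2 * w r \<le> P"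
    using r2_w_bounded[OF f'_le] by blast
  define E where "E r = r\<^sup>2 * (r\<^sup>2 * w r - 1 / \<beta>)" for r
  define z where "z r = v r / r" for r
  \<comment> \<open>The equation for \<open>E\<close> has the form
    \<open>E' = r * (N - z\<^sup>2 * E)\<close> with \<open>N\<close> bounded. Source and damping of
    \<open>w\<close> balance at \<open>r\<^sup>2 * w = 1 / z\<close>; measuring the deviation from
    \<open>1 / \<beta>\<close> instead leaves the last summand of \<open>N\<close>.\<close>
  define N where "N r = 3 * (r\<^sup>2 * w r) - 2 / \<beta> + r ^ 4 * z r * f' (u r) + r\<^sup>2 * z r * (\<beta> - z r) / \<beta>" for r
  let ?E' = "\<lambda>r. r * (N r - (z r)\<^sup>2 * E r)"
  have deriv_E: "\<forall>\<^sub>F r in at_top. (E has_real_derivative ?E' r) (at r)"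
    using deriv_w eventually_gt_at_top[of 0]
  proof eventually_elim
    case (elim r)
    let ?w' = "v r * (f' (u r) + 1 / r\<^sup>2) - (1 + (v r)\<^sup>2) * w r / r"
    have "(E has_real_derivative 2 * r * (r\<^sup>2 * w r - 1 / \<beta>) + r\<^sup>2 * (2 * r * w r + r\<^sup>2 * ?w')) (at r)"
      unfolding E_def using elim by (auto intro!: derivative_eq_intros)
    moreover have "v r = r * z r"
      using elim by (simp add: z_def)
    then have "2 * r * (r\<^sup>2 * w r - 1 / \<beta>) + r\<^sup>2 * (2 * r * w r + r\<^sup>2 * ?w') = ?E' r"
      unfolding N_def E_def using elim \<open>\<beta> > 0\<close>
      by (simp add: field_simps) (simp add: algebra_simps eval_nat_numeral)
    ultimately show ?case by simp
  qed
  \<comment> \<open>The slope quotient satisfies \<open>z - \<beta> = (f - \<beta>) - w\<close>, and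
    both parts are of order \<open>1 / r\<^sup>2\<close>; this keeps the last summand of
    \<open>N\<close> bounded.\<close>
  define Z where "Z = \<bar>M\<bar> + \<bar>P\<bar>"
  have z: "\<forall>\<^sub>F r in at_top. \<bar>z r - \<beta>\<bar> \<le> Z / r\<^sup>2"
    using f_lim P w_nonneg eventually_gt_at_top[of 0]
  proof eventually_elim
    case (elim r)
    have "w r \<le> P / r\<^sup>2"
      using elim by (simp add: field_simps)
    moreover have "z r - \<beta> = (f (u r) - \<beta>) - w r"
      by (simp add: z_def w_def)
    moreover have "M / r\<^sup>2 \<le> \<bar>M\<bar> / r\<^sup>2" "P / r\<^sup>2 \<le> \<bar>P\<bar> / r\<^sup>2"
      by (intro divide_right_mono; simp)+
    ultimately show ?case
      using elim by (simp add: Z_def add_divide_distrib)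
  qed
  define B where "B = 3 * \<bar>P\<bar> + 2 / \<beta> + (\<beta> + Z) * \<bar>M\<bar> + (\<beta> + Z) * Z / \<beta>"
  have N: "\<forall>\<^sub>F r in at_top. \<bar>N r\<bar> \<le> B"
    using z P w_nonneg f'_le f'_nonneg eventually_ge_at_top[of 1]
  proof eventually_elim
    case (elim r)
    have Z: "0 \<le> Z" by (simp add: Z_def)
    have "Z / r\<^sup>2 \<le> Z / 1"
      using elim Z by (intro divide_left_mono) auto
    then have z_le: "\<bar>z r\<bar> \<le> \<beta> + Z"
      using elim \<open>\<beta> > 0\<close> by linarith
    have 1: "\<bar>r\<^sup>2 * w r\<bar> \<le> \<bar>P\<bar>"
      using elim by (simp add: abs_mult)
    have "\<bar>r ^ 4 * f' (u r)\<bar> \<le> \<bar>M\<bar>"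
      using elim by (simp add: abs_mult field_simps)
    then have 2: "\<bar>r ^ 4 * z r * f' (u r)\<bar> \<le> (\<beta> + Z) * \<bar>M\<bar>"
      using mult_mono[OF z_le, of "\<bar>r ^ 4 * f' (u r)\<bar>" "\<bar>M\<bar>"] \<open>\<beta> > 0\<close> Z
      by (simp add: abs_mult mult_ac)
    have "\<bar>r\<^sup>2 * (\<beta> - z r)\<bar> = r\<^sup>2 * \<bar>z r - \<beta>\<bar>"
      by (simp add: abs_mult abs_minus_commute)
    also have "\<dots> \<le> Z"
      using elim by (simp add: field_simps)
    finally have "\<bar>r\<^sup>2 * z r * (\<beta> - z r)\<bar> \<le> (\<beta> + Z) * Z"
      using mult_mono[OF z_le, of "\<bar>r\<^sup>2 * (\<beta> - z r)\<bar>" Z] \<open>\<beta> > 0\<close> Z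
      by (simp add: abs_mult mult_ac)
    then have "\<bar>r\<^sup>2 * z r * (\<beta> - z r)\<bar> / \<beta> \<le> (\<beta> + Z) * Z / \<beta>"
      using \<open>\<beta> > 0\<close> by (intro divide_right_mono) auto
    then have 3: "\<bar>r\<^sup>2 * z r * (\<beta> - z r) / \<beta>\<bar> \<le> (\<beta> + Z) * Z / \<beta>"
      using \<open>\<beta> > 0\<close> by (simp add: abs_divide)
    have 4: "\<bar>2 / \<beta>\<bar> = 2 / \<beta>" using \<open>\<beta> > 0\<close> by simp
    show ?case
      unfolding N_def B_def using 1 2 3 4 by linarith
  qed
  \<comment> \<open>Since \<open>z \<ge> \<kappa>\<close>, the damping \<open>z\<^sup>2 * E\<close>
    overrules \<open>N\<close> once the modulus of \<open>E\<close> exceeds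
    \<open>B / \<kappa>\<^sup>2\<close>. The same inequality serves as an upper barrier for
    \<open>E\<close> and for \<open>- E\<close>.\<close>
  have barrier: "\<forall>\<^sub>F r in at_top. \<bar>E r\<bar> > B / \<kappa>\<^sup>2 \<longrightarrow> (z r)\<^sup>2 * \<bar>E r\<bar> \<ge> \<bar>N r\<bar>"
    using N v_lower eventually_gt_at_top[of 0]
  proof eventually_elim
    case (elim r)
    show ?case
    proof
      assume "\<bar>E r\<bar> > B / \<kappa>\<^sup>2"
      then have "B \<le> \<kappa>\<^sup>2 * \<bar>E r\<bar>"
        using \<kappa>_pos by (simp add: field_simps)
      also have "\<dots> \<le> (z r)\<^sup>2 * \<bar>E r\<bar>"
        using elim \<kappa>_pos by (intro mult_right_mono power_mono) (auto simp: z_def field_simps)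
      finally show "(z r)\<^sup>2 * \<bar>E r\<bar> \<ge> \<bar>N r\<bar>"
        using elim by simp
    qed
  qed
  have B: "B / \<kappa>\<^sup>2 \<ge> 0"
    using \<open>\<beta> > 0\<close> by (simp add: B_def Z_def)
  have "\<exists>K. \<forall>\<^sub>F r in at_top. E r \<le> K"
  proof (rule eventually_bounded_above_if_barrier[OF deriv_E])
    show "\<forall>\<^sub>F r in at_top. E r > B / \<kappa>\<^sup>2 \<longrightarrow> ?E' r \<le> 0"
      using barrier eventually_gt_at_top[of 0]
    proof eventually_elim
      case (elim r)
      then show ?case using B by (auto intro!: mult_nonneg_nonpos)
    qed
  qed
  moreover have "\<exists>K. \<forall>\<^sub>F r in at_top. - E r \<le> K"
  proof (rule eventually_bounded_above_if_barrier)
    show "\<forall>\<^sub>F r in at_top. ((\<lambda>r. - E r) has_real_derivative - ?E' r) (at r)"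
      using deriv_E by eventually_elim (rule DERIV_minus)
    show "\<forall>\<^sub>F r in at_top. - E r > B / \<kappa>\<^sup>2 \<longrightarrow> - ?E' r \<le> 0"
      using barrier eventually_gt_at_top[of 0]
    proof eventually_elim
      case (elim r)
      then show ?case using B by (auto intro!: mult_nonneg_nonneg)
    qed
  qed
  ultimately obtain K1 K2 where "\<forall>\<^sub>F r in at_top. E r \<le> K1" "\<forall>\<^sub>F r in at_top. - E r \<le> K2"
    by blast
  then have "\<forall>\<^sub>F r in at_top. \<bar>E r\<bar> \<le> max K1 K2"
    by eventually_elim auto
  then show ?thesis unfolding E_def by blast
qed

text \<open>After subtraction of the two leading terms the derivative is of order
  \<open>1 / r ^ 3\<close>. It is therefore integrable at infinity: the limit is the additive
  constant \<open>d\<close>, and the tail is of order \<open>1 / r\<^sup>2\<close>.\<close>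

lemma primitive_asymptotics:
  assumes f'_le: "\<forall>\<^sub>F r in at_top. f' (u r) \<le> M / r ^ 4"
    and f_lim: "\<forall>\<^sub>F r in at_top. \<bar>f (u r) - \<beta>\<bar> \<le> M / r\<^sup>2"
    and "\<beta> > 0"
    and G: "\<forall>\<^sub>F r in at_top. (G has_real_derivative 1 / f (u r)) (at (u r))"
  shows "\<exists>d. (\<lambda>r. (G (u r) - d) - (r\<^sup>2 / 2 - ln r / \<beta>\<^sup>2)) \<in> O[at_top](\<lambda>r. 1 / r\<^sup>2)"
proof -
  obtain K where K: "\<forall>\<^sub>F r in at_top. \<bar>r\<^sup>2 * (r\<^sup>2 * w r - 1 / \<beta>)\<bar> \<le> K"
    using r2_w_asymptotics[OF assms(1-3)] by blast
  \<comment> \<open>The numerator bounds the one in the exact formula for \<open>?y'\<close> below,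
    and \<open>\<beta> / 2\<close> is a lower bound for \<open>f (u r)\<close> at large
    \<open>r\<close>.\<close>
  define C where "C = (\<bar>M\<bar> + \<beta>\<^sup>2 * \<bar>K\<bar>) / (\<beta>\<^sup>2 * (\<beta> / 2))"
  let ?y' = "\<lambda>r. v r / f (u r) - (r - 1 / (\<beta>\<^sup>2 * r))"
  have "\<exists>d. \<forall>\<^sub>F r in at_top. \<bar>(G (u r) - (r\<^sup>2 / 2 - ln r / \<beta>\<^sup>2)) - d\<bar> \<le> C / 2 * (1 / r\<^sup>2)"
  proof (rule converges_if_deriv_bounded)
    show "\<forall>\<^sub>F r in at_top. ((\<lambda>r. G (u r) - (r\<^sup>2 / 2 - ln r / \<beta>\<^sup>2)) has_real_derivative ?y' r) (at r)"
      using G deriv_u eventually_gt_at_top[of 0]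
    proof eventually_elim
      case (elim r)
      have "((\<lambda>r. G (u r)) has_real_derivative 1 / f (u r) * v r) (at r)"
        using elim by (intro DERIV_chain2) auto
      then show ?case
        using elim \<open>\<beta> > 0\<close>
        by (auto intro!: derivative_eq_intros simp: field_simps power2_eq_square power4_eq_xxxx)
    qed
    show "\<forall>\<^sub>F r in at_top. ((\<lambda>r. C / 2 * (1 / r\<^sup>2)) has_real_derivative - C / r ^ 3) (at r)"
      using eventually_gt_at_top[of 0]
      by eventually_elim (auto intro!: derivative_eq_intros simp: power2_eq_square power3_eq_cube)
    have "\<forall>\<^sub>F r in at_top. M / r\<^sup>2 \<le> \<beta> / 2"
      using \<open>\<beta> > 0\<close> by real_asymp
    then show "\<forall>\<^sub>F r in at_top. \<bar>?y' r\<bar> \<le> - (- C / r ^ 3)"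
      using K f_lim eventually_gt_at_top[of 0]
    proof eventually_elim
      case (elim r)
      define F where "F = f (u r)"
      define E where "E = r\<^sup>2 * (r\<^sup>2 * w r - 1 / \<beta>)"
      have F: "F \<ge> \<beta> / 2" using elim unfolding F_def by linarith
      then have "F > 0" using \<open>\<beta> > 0\<close> by simp
      have w: "w r = (1 / \<beta> + E / r\<^sup>2) / r\<^sup>2"
        using elim by (simp add: E_def)
      have v: "v r = r * (F - w r)"
        using v_eq elim by (simp add: F_def)
      \<comment> \<open>Inserting \<open>w = (1 / \<beta> + E / r\<^sup>2) / r\<^sup>2\<close>
        cancels the terms of order \<open>1 / r\<close>; both remaining numerator terms are
        bounded.\<close>
      have "?y' r = (r\<^sup>2 * (F - \<beta>) - \<beta>\<^sup>2 * E) / (\<beta>\<^sup>2 * F * r ^ 3)"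
        unfolding v w F_def[symmetric] using elim \<open>F > 0\<close> \<open>\<beta> > 0\<close>
        by (simp add: field_simps) (simp add: algebra_simps eval_nat_numeral)
      also have "\<bar>\<dots>\<bar> = \<bar>r\<^sup>2 * (F - \<beta>) - \<beta>\<^sup>2 * E\<bar> / (\<beta>\<^sup>2 * F * r ^ 3)"
        using elim \<open>F > 0\<close> \<open>\<beta> > 0\<close> by (simp add: abs_divide abs_mult)
      also have "\<dots> \<le> (\<bar>M\<bar> + \<beta>\<^sup>2 * \<bar>K\<bar>) / (\<beta>\<^sup>2 * (\<beta> / 2) * r ^ 3)"
      proof (rule frac_le)
        have "\<bar>r\<^sup>2 * (F - \<beta>)\<bar> \<le> \<bar>M\<bar>"
        proof -
          have "\<bar>r\<^sup>2 * (F - \<beta>)\<bar> = r\<^sup>2 * \<bar>f (u r) - \<beta>\<bar>"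
            by (simp add: F_def abs_mult)
          also have "\<dots> \<le> M"
            using elim by (simp add: field_simps)
          finally show ?thesis by simp
        qed
        moreover have "\<bar>\<beta>\<^sup>2 * E\<bar> \<le> \<beta>\<^sup>2 * \<bar>K\<bar>"
          using elim by (simp add: E_def abs_mult mult_left_mono)
        ultimately show "\<bar>r\<^sup>2 * (F - \<beta>) - \<beta>\<^sup>2 * E\<bar> \<le> \<bar>M\<bar> + \<beta>\<^sup>2 * \<bar>K\<bar>"
          by linarith
        show "\<beta>\<^sup>2 * (\<beta> / 2) * r ^ 3 \<le> \<beta>\<^sup>2 * F * r ^ 3"
          using F elim by (intro mult_right_mono mult_left_mono) auto
      qed (use elim \<open>\<beta> > 0\<close> in auto)
      also have "\<dots> = - (- C / r ^ 3)"
        by (simp add: C_def)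
      finally show ?case .
    qed
    show "\<forall>\<^sub>F r in at_top. C / 2 * (1 / r\<^sup>2) \<ge> 0"
      using \<open>\<beta> > 0\<close> by (simp add: C_def)
  qed
  then obtain d where d: "\<forall>\<^sub>F r in at_top.
      \<bar>(G (u r) - (r\<^sup>2 / 2 - ln r / \<beta>\<^sup>2)) - d\<bar> \<le> C / 2 * (1 / r\<^sup>2)" ..
  show ?thesis
  proof (intro exI bigoI)
    show "\<forall>\<^sub>F r in at_top. norm ((G (u r) - d) - (r\<^sup>2 / 2 - ln r / \<beta>\<^sup>2)) \<le> C / 2 * norm (1 / r\<^sup>2)"
      using d by eventually_elim (simp add: algebra_simps)
  qed
qed

section \<open>The case in which \<open>f\<close> is asymptotically linear\<close>

text \<open>The logarithmic derivative is \<open>v / u = r * (f - w) / u\<close>, where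
  \<open>f / u\<close> lies between \<open>\<alpha> / 2\<close> and \<open>2 * \<alpha>\<close> and
  \<open>w\<close> is nonnegative and eventually at most \<open>\<alpha> / 4 * u\<close>. The upper
  bound turns logarithmic errors in \<open>u\<close> into errors of order \<open>r\<^sup>2\<close>;
  the lower bound later forces the leading coefficient to be positive.\<close>

lemma ln_u_bounds:
  assumes f_lin: "\<forall>\<^sub>F x in at_top. \<alpha> / 2 * x \<le> f x \<and> f x \<le> 2 * \<alpha> * x"
    and "\<alpha> > 0"
    and w_bdd: "\<forall>\<^sub>F r in at_top. w r \<le> K"
  shows "\<exists>C. \<forall>\<^sub>F r in at_top. \<alpha> / 8 * r\<^sup>2 \<le> ln (u r) + C"
    and "\<exists>C. \<forall>\<^sub>F r in at_top. ln (u r) \<le> \<alpha> * r\<^sup>2 + C"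
proof -
  have u_ge: "\<forall>\<^sub>F r in at_top. u r \<ge> X" for X
    using u_at_top unfolding filterlim_at_top by blast
  have f_u: "\<forall>\<^sub>F r in at_top. \<alpha> / 2 * u r \<le> f (u r) \<and> f (u r) \<le> 2 * \<alpha> * u r"
    using f_lin u_at_top by (rule eventually_compose_filterlim)
  have der: "\<forall>\<^sub>F r in at_top. ((\<lambda>r. ln (u r)) has_real_derivative v r / u r) (at r)"
    using deriv_u u_ge[of 1] by eventually_elim (auto intro!: derivative_eq_intros)
  have quad: "\<forall>\<^sub>F r in at_top. ((\<lambda>r. b / 2 * r\<^sup>2) has_real_derivative b * r) (at r)" for b :: real
    by (intro always_eventually allI) (auto intro!: derivative_eq_intros)
  have "\<exists>C. \<forall>\<^sub>F r in at_top. \<alpha> / 4 / 2 * r\<^sup>2 \<le> ln (u r) + C"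
  proof (rule eventually_le_if_deriv_le[OF quad der])
    show "\<forall>\<^sub>F r in at_top. \<alpha> / 4 * r \<le> v r / u r"
      using f_u u_ge[of "max 1 (4 * K / \<alpha>)"] w_bdd eventually_gt_at_top[of 0]
    proof eventually_elim
      case (elim r)
      then have "K \<le> \<alpha> / 4 * u r" using \<open>\<alpha> > 0\<close> by (simp add: field_simps)
      then have "\<alpha> / 4 * u r \<le> f (u r) - w r" using elim by simp
      then have "r * (\<alpha> / 4 * u r) \<le> v r"
        using elim by (subst v_eq) auto
      then show ?case using elim by (simp add: field_simps)
    qed
  qed
  then show "\<exists>C. \<forall>\<^sub>F r in at_top. \<alpha> / 8 * r\<^sup>2 \<le> ln (u r) + C" by simp
  have "\<exists>C. \<forall>\<^sub>F r in at_top. ln (u r) \<le> 2 * \<alpha> / 2 * r\<^sup>2 + C"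
  proof (rule eventually_le_if_deriv_le[OF der quad])
    show "\<forall>\<^sub>F r in at_top. v r / u r \<le> 2 * \<alpha> * r"
      using f_u u_ge[of 1] w_nonneg eventually_gt_at_top[of 0]
    proof eventually_elim
      case (elim r)
      then have "v r \<le> r * (2 * \<alpha> * u r)"
        by (subst v_eq) auto
      then show ?case using elim by (simp add: field_simps)
    qed
  qed
  then show "\<exists>C. \<forall>\<^sub>F r in at_top. ln (u r) \<le> \<alpha> * r\<^sup>2 + C" by simp
qed

lemma potential_asymptotics:
  assumes der_\<phi>: "\<forall>\<^sub>F x in at_top. (\<phi> has_real_derivative f x) (at x)"
    and der_f: "\<forall>\<^sub>F x in at_top. (f has_real_derivative f' x) (at x)"
    and f_lim: "\<forall>\<^sub>F x in at_top. \<bar>f x - (\<alpha> * x + \<beta>)\<bar> \<le> M / x"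
    and f'_lim: "\<forall>\<^sub>F x in at_top. \<bar>f' x - \<alpha>\<bar> \<le> M / x\<^sup>2"
    and "\<alpha> > 0"
  shows "\<exists>C>0. (\<lambda>r. \<phi> (u r) - C * exp (\<alpha> * r\<^sup>2)) \<in> O[at_top](\<lambda>r. r\<^sup>2)"
proof -
  have u_ge: "\<forall>\<^sub>F r in at_top. u r \<ge> X" for X
    using u_at_top unfolding filterlim_at_top by blast
  have "\<forall>\<^sub>F x::real in at_top. M / x - \<beta> \<le> \<alpha> / 2 * x"
       "\<forall>\<^sub>F x::real in at_top. M / x + \<beta> \<le> \<alpha> * x"
    using \<open>\<alpha> > 0\<close> by real_asymp+
  then have f_lin: "\<forall>\<^sub>F x in at_top. \<alpha> / 2 * x \<le> f x \<and> f x \<le> 2 * \<alpha> * x"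
    using f_lim by eventually_elim linarith
  have f_u_at_top: "filterlim (\<lambda>r. f (u r)) at_top at_top"
  proof (rule filterlim_at_top_mono)
    show "filterlim (\<lambda>r. \<alpha> / 2 * u r) at_top at_top"
      using \<open>\<alpha> > 0\<close> u_at_top by (intro filterlim_tendsto_pos_mult_at_top[OF tendsto_const]) auto
    show "\<forall>\<^sub>F r in at_top. \<alpha> / 2 * u r \<le> f (u r)"
      using eventually_compose_filterlim[OF f_lin u_at_top] by eventually_elim simp
  qed
  have "\<forall>\<^sub>F x::real in at_top. M / x\<^sup>2 \<le> 1"
    by real_asymp
  then have "\<forall>\<^sub>F x in at_top. f' x \<le> \<alpha> + 1"
    using f'_lim by eventually_elim simp
  then have f'_le: "\<forall>\<^sub>F r in at_top. f' (u r) \<le> \<alpha> + 1"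
    using u_at_top by (rule eventually_compose_filterlim)
  obtain Q where Q: "\<forall>\<^sub>F r in at_top. f (u r) * w r \<le> Q"
    using w_f_bounded[OF f'_le f_u_at_top] by blast
  obtain K where w_bdd: "\<forall>\<^sub>F r in at_top. w r \<le> K"
    using w_bounded[OF f'_le] by blast
  obtain C1 C2 where C1: "\<forall>\<^sub>F r in at_top. \<alpha> / 8 * r\<^sup>2 \<le> ln (u r) + C1"
    and C2: "\<forall>\<^sub>F r in at_top. ln (u r) \<le> \<alpha> * r\<^sup>2 + C2"
    using ln_u_bounds[OF f_lin \<open>\<alpha> > 0\<close> w_bdd] by blast
  have "\<exists>A\<ge>0. \<forall>\<^sub>F x in at_top. \<bar>(f x)\<^sup>2 - 2 * \<alpha> * \<phi> x\<bar> \<le> A * ln x"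
  proof (rule ln_growth_if_deriv_near_linear[OF der_\<phi> der_f _ f'_lim])
    show "\<forall>\<^sub>F x in at_top. \<bar>f x\<bar> \<le> 2 * \<alpha> * x"
      using f_lin eventually_gt_at_top[of 0]
    proof eventually_elim
      case (elim x)
      have "0 \<le> \<alpha> / 2 * x" using elim \<open>\<alpha> > 0\<close> by simp
      then show ?case using elim by linarith
    qed
  qed
  then obtain A where "A \<ge> 0" and A: "\<forall>\<^sub>F x in at_top. \<bar>(f x)\<^sup>2 - 2 * \<alpha> * \<phi> x\<bar> \<le> A * ln x"
    by blast
  have A_u: "\<forall>\<^sub>F r in at_top. \<bar>(f (u r))\<^sup>2 - 2 * \<alpha> * \<phi> (u r)\<bar> \<le> A * ln (u r)"
    using A u_at_top by (rule eventually_compose_filterlim)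
  \<comment> \<open>Eventually the integration constant \<open>C2\<close> and the bound on
    \<open>f * w\<close> are each at most \<open>r\<^sup>2\<close>; they account for the two
    summands 1 added to \<open>A * \<alpha>\<close>, the first one multiplied by
    \<open>A\<close>.\<close>
  define B where "B = A * (\<alpha> + 1) + 1"
  have "B > 0" using \<open>A \<ge> 0\<close> \<open>\<alpha> > 0\<close> by (simp add: B_def add_nonneg_pos)
  \<comment> \<open>Integration by parts yields this primitive: its derivative is
    \<open>- B * r ^ 3 * exp (- (\<alpha> * r\<^sup>2))\<close>, and it tends to 0 at
    infinity.\<close>
  define k where "k r = B * (r\<^sup>2 / (2 * \<alpha>) + 1 / (2 * \<alpha>\<^sup>2)) * exp (- (\<alpha> * r\<^sup>2))" for r
  let ?y' = "\<lambda>r. (f (u r) * v r - 2 * \<alpha> * r * \<phi> (u r)) * exp (- (\<alpha> * r\<^sup>2))"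
  have "\<exists>C. \<forall>\<^sub>F r in at_top. \<bar>\<phi> (u r) * exp (- (\<alpha> * r\<^sup>2)) - C\<bar> \<le> k r"
  proof (rule converges_if_deriv_bounded)
    show "\<forall>\<^sub>F r in at_top. ((\<lambda>r. \<phi> (u r) * exp (- (\<alpha> * r\<^sup>2))) has_real_derivative ?y' r) (at r)"
      using eventually_compose_filterlim[OF der_\<phi> u_at_top] deriv_u
    proof eventually_elim
      case (elim r)
      have "((\<lambda>r. \<phi> (u r)) has_real_derivative f (u r) * v r) (at r)"
        using elim by (intro DERIV_chain2) auto
      then show ?case
        by (auto intro!: derivative_eq_intros simp: algebra_simps)
    qed
    show "\<forall>\<^sub>F r in at_top. (k has_real_derivative - (B * r ^ 3 * exp (- (\<alpha> * r\<^sup>2)))) (at r)"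
      unfolding k_def using \<open>\<alpha> > 0\<close>
      by (intro always_eventually allI)
         (auto intro!: derivative_eq_intros simp: field_simps power2_eq_square power3_eq_cube)
    have "\<forall>\<^sub>F r::real in at_top. A * (\<alpha> * r\<^sup>2 + C2) + \<bar>Q\<bar> \<le> (A * (\<alpha> + 1) + 1) * r\<^sup>2"
    proof -
      have "\<forall>\<^sub>F r::real in at_top. \<bar>C2\<bar> \<le> r\<^sup>2" "\<forall>\<^sub>F r::real in at_top. \<bar>Q\<bar> \<le> r\<^sup>2"
        by real_asymp+
      then show ?thesis
      proof eventually_elim
        case (elim r)
        have "A * C2 \<le> A * r\<^sup>2"
          using elim \<open>A \<ge> 0\<close> by (intro mult_left_mono) auto
        then show ?case using elim by (simp add: algebra_simps)
      qed
    qed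
    then show "\<forall>\<^sub>F r in at_top. \<bar>?y' r\<bar> \<le> - (- (B * r ^ 3 * exp (- (\<alpha> * r\<^sup>2))))"
      using A_u Q C2 w_nonneg eventually_gt_at_top[of 0]
        f_u_at_top[unfolded filterlim_at_top, rule_format, of 0]
    proof eventually_elim
      case (elim r)
      define h where "h = (f (u r))\<^sup>2 - 2 * \<alpha> * \<phi> (u r)"
      define q where "q = f (u r) * w r"
      have "\<bar>h\<bar> \<le> A * (\<alpha> * r\<^sup>2 + C2)"
        using elim mult_left_mono[OF \<open>ln (u r) \<le> \<alpha> * r\<^sup>2 + C2\<close> \<open>A \<ge> 0\<close>] by (simp add: h_def)
      moreover have "\<bar>q\<bar> \<le> \<bar>Q\<bar>"
        using elim by (simp add: q_def abs_mult)
      ultimately have "\<bar>h - q\<bar> \<le> B * r\<^sup>2"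
        using elim unfolding B_def by linarith
      then have le: "r * \<bar>h - q\<bar> \<le> r * (B * r\<^sup>2)"
        using elim by (intro mult_left_mono) auto
      \<comment> \<open>Substituting \<open>v = r * (f - w)\<close> splits the error into
        \<open>h\<close>, controlled by \<open>ln u\<close>, and the bounded quantity
        \<open>q\<close>.\<close>
      have "f (u r) * v r - 2 * \<alpha> * r * \<phi> (u r) = r * (h - q)"
        using elim by (subst v_eq) (auto simp: h_def q_def algebra_simps power2_eq_square)
      then have "\<bar>f (u r) * v r - 2 * \<alpha> * r * \<phi> (u r)\<bar> \<le> B * r ^ 3"
        using le elim by (simp add: abs_mult power2_eq_square power3_eq_cube mult_ac)
      then show ?case
        by (simp add: abs_mult)
    qed
    show "\<forall>\<^sub>F r in at_top. k r \<ge> 0"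
      using \<open>B > 0\<close> \<open>\<alpha> > 0\<close> by (simp add: k_def)
  qed
  then obtain C where C: "\<forall>\<^sub>F r in at_top. \<bar>\<phi> (u r) * exp (- (\<alpha> * r\<^sup>2)) - C\<bar> \<le> k r" ..
  define D where "D = B * (1 / (2 * \<alpha>) + 1 / (2 * \<alpha>\<^sup>2))"
  have diff: "\<forall>\<^sub>F r in at_top. \<bar>\<phi> (u r) - C * exp (\<alpha> * r\<^sup>2)\<bar> \<le> D * r\<^sup>2"
    using C eventually_ge_at_top[of 1]
  proof eventually_elim
    case (elim r)
    have "\<phi> (u r) - C * exp (\<alpha> * r\<^sup>2) = (\<phi> (u r) * exp (- (\<alpha> * r\<^sup>2)) - C) * exp (\<alpha> * r\<^sup>2)"
      by (simp add: left_diff_distrib mult.assoc flip: exp_add)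
    also have "\<bar>\<dots>\<bar> \<le> k r * exp (\<alpha> * r\<^sup>2)"
      using elim by (simp add: abs_mult)
    also have "\<dots> = B * (r\<^sup>2 / (2 * \<alpha>) + 1 / (2 * \<alpha>\<^sup>2))"
      by (simp add: k_def mult.assoc flip: exp_add)
    also have "\<dots> \<le> B * (r\<^sup>2 / (2 * \<alpha>) + r\<^sup>2 / (2 * \<alpha>\<^sup>2))"
      using \<open>B > 0\<close> \<open>\<alpha> > 0\<close> elim by (intro mult_left_mono add_left_mono divide_right_mono) auto
    also have "\<dots> = D * r\<^sup>2"
      by (simp add: D_def algebra_simps)
    finally show ?case .
  qed
  \<comment> \<open>Otherwise \<open>\<phi> (u r)\<close> would be at most
    \<open>D * r\<^sup>2\<close>. As \<open>f\<close> is eventually at least 2,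
    \<open>\<phi> x\<close> eventually dominates \<open>2 * x\<close> up to a constant, so
    \<open>u r\<close> would be at most \<open>D * r\<^sup>2\<close> too, against its lower bound
    \<open>exp (\<alpha> / 8 * r\<^sup>2 - C1)\<close>.\<close>
  have "C > 0"
  proof (rule ccontr)
    assume "\<not> C > 0"
    have "\<exists>C. \<forall>\<^sub>F x in at_top. 2 * x \<le> \<phi> x + C"
    proof (rule eventually_le_if_deriv_le[OF _ der_\<phi>])
      show "\<forall>\<^sub>F x in at_top. ((\<lambda>x::real. 2 * x) has_real_derivative 2) (at x)"
        by (intro always_eventually allI) (auto intro!: derivative_eq_intros)
      have "\<forall>\<^sub>F x::real in at_top. \<alpha> / 2 * x \<ge> 2"
        using \<open>\<alpha> > 0\<close> by real_asymp
      then show "\<forall>\<^sub>F x in at_top. 2 \<le> f x"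
        using f_lin by eventually_elim simp
    qed
    then obtain C3 where "\<forall>\<^sub>F x in at_top. 2 * x \<le> \<phi> x + C3" ..
    then have "\<forall>\<^sub>F r in at_top. 2 * u r \<le> \<phi> (u r) + C3"
      using u_at_top by (rule eventually_compose_filterlim)
    moreover have "\<forall>\<^sub>F r::real in at_top. exp (\<alpha> / 8 * r\<^sup>2 - C1) > D * r\<^sup>2"
      using \<open>\<alpha> > 0\<close> by real_asymp
    ultimately have "\<forall>\<^sub>F r::real in at_top. False"
      using C1 diff u_ge[of "max 1 C3"]
    proof eventually_elim
      case (elim r)
      have "C * exp (\<alpha> * r\<^sup>2) \<le> 0"
        using \<open>\<not> C > 0\<close> by (simp add: mult_le_0_iff)
      then have "u r \<le> D * r\<^sup>2"
        using elim by linarith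
      moreover have "exp (\<alpha> / 8 * r\<^sup>2 - C1) \<le> exp (ln (u r))"
        using elim by (subst exp_le_cancel_iff) linarith
      ultimately show False
        using elim by simp
    qed
    then show False by simp
  qed
  moreover have "(\<lambda>r. \<phi> (u r) - C * exp (\<alpha> * r\<^sup>2)) \<in> O[at_top](\<lambda>r. r\<^sup>2)"
    using diff by (intro bigoI[of _ D]) simp
  ultimately show ?thesis by blast
qed

end

subsection \<open>Rotational graphs\<close>

lemma right_ray_upward: "x \<in> right_ray a \<Longrightarrow> x \<le> y \<Longrightarrow> y \<in> right_ray a"
  unfolding right_ray_def by (auto intro: less_le_trans)

lemma open_right_ray: "open (right_ray a)"
  unfolding right_ray_def by (intro open_Collect_less continuous_intros)

lemma deriv_primitive_G:
  assumes cont: "continuous_on (right_ray a) (deriv \<phi>)"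
    and pos: "\<And>x. x \<in> right_ray a \<Longrightarrow> deriv \<phi> x > 0"
    and u0: "u0 \<in> right_ray a" and x: "x \<in> right_ray a"
  shows "(primitive_G \<phi> u0 has_real_derivative 1 / deriv \<phi> x) (at x)"
proof -
  obtain e where "e > 0" and e: "cball x e \<subseteq> right_ray a"
    using open_right_ray x open_contains_cball by metis
  \<comment> \<open>The interval contains the base point \<open>u0\<close> and has \<open>x\<close>
    in its interior, whichever of the two is larger; the one-interval fundamental theorem thus
    yields a two-sided derivative at \<open>x\<close>.\<close>
  define p q where "p = min u0 (x - e)" and "q = max u0 (x + e)"
  have "x - e \<in> right_ray a"
    using e \<open>e > 0\<close> by (auto simp: dist_real_def)
  then have "p \<in> right_ray a"
    using u0 by (simp add: p_def min_def)
  then have sub: "{p..q} \<subseteq> right_ray a"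
    using right_ray_upward by (meson atLeastAtMost_iff subsetI)
  have "continuous_on {p..q} (\<lambda>\<xi>. 1 / deriv \<phi> \<xi>)"
    using pos sub by (intro continuous_intros continuous_on_subset[OF cont sub]) force
  then have "((\<lambda>u. LBINT \<xi>=u0..u. 1 / deriv \<phi> \<xi>) has_vector_derivative 1 / deriv \<phi> x)
      (at x within {p..q})"
    using \<open>e > 0\<close> by (intro interval_integral_FTC2) (auto simp: p_def q_def)
  moreover have "at x within {p..q} = at x"
    using \<open>e > 0\<close> by (intro at_within_Icc_at) (auto simp: p_def q_def)
  ultimately show ?thesis
    by (simp add: has_real_derivative_iff_has_vector_derivative primitive_G_def[abs_def])
qed

lemma strict_mono_primitive_G:
  assumes cont: "continuous_on (right_ray a) (deriv \<phi>)"
    and pos: "\<And>x. x \<in> right_ray a \<Longrightarrow> deriv \<phi> x > 0"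
    and u0: "u0 \<in> right_ray a"
  shows "strict_mono_on (right_ray a) (primitive_G \<phi> u0)"
proof (rule strict_mono_onI)
  fix x y assume "x \<in> right_ray a" "y \<in> right_ray a" "x < y"
  show "primitive_G \<phi> u0 x < primitive_G \<phi> u0 y"
  proof (rule DERIV_pos_imp_increasing[OF \<open>x < y\<close>])
    fix t assume "x \<le> t" "t \<le> y"
    then have "t \<in> right_ray a"
      using \<open>x \<in> right_ray a\<close> right_ray_upward by blast
    then show "\<exists>d. (primitive_G \<phi> u0 has_real_derivative d) (at t) \<and> 0 < d"
      using deriv_primitive_G[OF cont pos u0] pos[of t]
      by (intro exI[of _ "1 / deriv \<phi> t"]) simp
  qed
qed

text \<open>The equation makes \<open>v\<close> increase wherever it is negative, so
  \<open>v\<close> stays nonnegative. Hence \<open>u\<close> never drops below \<open>u0\<close>,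
  and since \<open>deriv \<phi>\<close> is nondecreasing, \<open>deriv \<phi> (u r)\<close> stays
  above its initial value \<open>m\<close>. This drives the linear growth of
  \<open>v\<close>.\<close>

lemma radial_profile_of_graph:
  assumes der2: "\<And>x. x \<in> right_ray a \<Longrightarrow>
      (deriv \<phi> has_real_derivative deriv (deriv \<phi>) x) (at x)"
    and pos: "\<And>x. x \<in> right_ray a \<Longrightarrow> deriv \<phi> x > 0"
    and nonneg: "\<And>x. x \<in> right_ray a \<Longrightarrow> deriv (deriv \<phi>) x \<ge> 0"
    and "r0 \<ge> 0" "u0 \<in> right_ray a" "u1 \<ge> 0"
    and graph: "rotational_minimal_graph \<phi> (right_ray a) r0 u0 u1 u"
  shows "\<exists>v \<kappa>. radial_profile (deriv \<phi>) (deriv (deriv \<phi>)) u v \<kappa>"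
proof -
  obtain v v' where u_ray: "\<And>r. r \<ge> r0 \<Longrightarrow> u r \<in> right_ray a"
    and der_u: "\<And>r. r \<ge> r0 \<Longrightarrow> (u has_real_derivative v r) (at r within {r0..})"
    and der_v: "\<And>r. r \<ge> r0 \<Longrightarrow> (v has_real_derivative v' r) (at r within {r0..})"
    and ode: "\<And>r. r \<ge> r0 \<Longrightarrow> r > 0 \<Longrightarrow> v' r = (1 + (v r)\<^sup>2) * (deriv \<phi> (u r) - v r / r)"
    and init: "u r0 = u0" "v r0 = u1"
    using graph unfolding rotational_minimal_graph_def by blast
  have at_r: "at r within {r0..} = at r" if "r > r0" for r
    using that by (intro at_within_interior) simp
  have deriv_u: "(u has_real_derivative v r) (at r)" if "r > r0" for r
    using der_u[of r] that at_r by simp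
  have deriv_v: "(v has_real_derivative (1 + (v r)\<^sup>2) * (deriv \<phi> (u r) - v r / r)) (at r)"
    if "r > r0" for r
    using der_v[of r] that at_r ode[of r] \<open>r0 \<ge> 0\<close> by simp
  have cont_u: "continuous_on {r0..} u" and cont_v: "continuous_on {r0..} v"
    using der_u der_v by (auto intro!: DERIV_continuous_on)
  have v_nonneg: "v r \<ge> 0" if "r \<ge> r0" for r
  proof (rule nonneg_if_deriv_nonneg_where_neg[OF cont_v deriv_v])
    show "0 \<le> (1 + (v x)\<^sup>2) * (deriv \<phi> (u x) - v x / x)" if "x > r0" "v x < 0" for x
    proof -
      have "v x / x \<le> 0"
        using that \<open>r0 \<ge> 0\<close> by (intro divide_nonpos_pos) auto
      moreover have "deriv \<phi> (u x) > 0"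
        using that by (intro pos u_ray) simp
      ultimately show ?thesis by simp
    qed
  qed (use that init \<open>u1 \<ge> 0\<close> in auto)
  have u_ge: "u r \<ge> u0" if "r \<ge> r0" for r
  proof -
    have "u r - u0 \<ge> 0"
    proof (rule nonneg_if_deriv_nonneg_where_neg[of r0 "\<lambda>r. u r - u0" v])
      show "continuous_on {r0..} (\<lambda>r. u r - u0)"
        by (intro continuous_intros cont_u)
      show "((\<lambda>r. u r - u0) has_real_derivative v r) (at r)" if "r > r0" for r
        using deriv_u[OF that] by (auto intro!: derivative_eq_intros)
    qed (use that init v_nonneg in auto)
    then show ?thesis by simp
  qed
  define m where "m = deriv \<phi> u0"
  have "m > 0" using pos \<open>u0 \<in> right_ray a\<close> by (simp add: m_def)
  have m_le: "m \<le> deriv \<phi> (u r)" if "r \<ge> r0" for r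
    unfolding m_def
  proof (rule DERIV_nonneg_imp_nondecreasing[OF u_ge[OF that]])
    fix x assume "u0 \<le> x" "x \<le> u r"
    then have "x \<in> right_ray a"
      using \<open>u0 \<in> right_ray a\<close> right_ray_upward by blast
    then show "\<exists>d. (deriv \<phi> has_real_derivative d) (at x) \<and> 0 \<le> d"
      using der2 nonneg by blast
  qed
  \<comment> \<open>The weight \<open>r\<close> removes the singular quotient: with
    \<open>f = deriv \<phi> (u r)\<close>, the derivative of \<open>r * v\<close> is
    \<open>r * f + v\<^sup>2 * (r * f - v)\<close>. Below the barrier
    \<open>v \<le> m * r \<le> r * f\<close>, so the second term is nonnegative and the first is at
    least \<open>m * r\<close>, the derivative of the comparison function.\<close>
  have rv_ge: "r * v r - m * (r\<^sup>2 - r0\<^sup>2) / 2 \<ge> 0" if "r \<ge> r0" for r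
  proof (rule nonneg_if_deriv_nonneg_where_neg[of r0 "\<lambda>r. r * v r - m * (r\<^sup>2 - r0\<^sup>2) / 2"
        "\<lambda>r. v r + r * ((1 + (v r)\<^sup>2) * (deriv \<phi> (u r) - v r / r)) - m * r"])
    show "continuous_on {r0..} (\<lambda>r. r * v r - m * (r\<^sup>2 - r0\<^sup>2) / 2)"
      by (intro continuous_intros cont_v) simp
    show "((\<lambda>r. r * v r - m * (r\<^sup>2 - r0\<^sup>2) / 2) has_real_derivative
        v r + r * ((1 + (v r)\<^sup>2) * (deriv \<phi> (u r) - v r / r)) - m * r) (at r)" if "r > r0" for r
      using deriv_v[OF that] by (auto intro!: derivative_eq_intros)
    show "0 \<le> v r + r * ((1 + (v r)\<^sup>2) * (deriv \<phi> (u r) - v r / r)) - m * r"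
      if r: "r > r0" and neg: "r * v r - m * (r\<^sup>2 - r0\<^sup>2) / 2 < 0" for r
    proof -
      have "r > 0" using r \<open>r0 \<ge> 0\<close> by simp
      have "m * (r\<^sup>2 - r0\<^sup>2) / 2 \<le> m * r\<^sup>2"
        using \<open>m > 0\<close> by (simp add: algebra_simps)
      then have "r * v r \<le> r * (m * r)"
        using neg by (simp add: power2_eq_square mult_ac)
      then have "v r \<le> m * r"
        using \<open>r > 0\<close> by simp
      also have "\<dots> \<le> deriv \<phi> (u r) * r"
        using m_le[of r] r \<open>r > 0\<close> by simp
      finally have "(v r)\<^sup>2 * (r * deriv \<phi> (u r) - v r) \<ge> 0"
        by (simp add: mult.commute)
      moreover have "m * r \<le> r * deriv \<phi> (u r)"
        using m_le[of r] r \<open>r > 0\<close> by simp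
      moreover have "r * ((1 + (v r)\<^sup>2) * (deriv \<phi> (u r) - v r / r)) =
          (1 + (v r)\<^sup>2) * (r * deriv \<phi> (u r) - v r)"
        using \<open>r > 0\<close> by (simp add: field_simps)
      ultimately show ?thesis
        by (simp add: distrib_right)
    qed
  qed (use that init \<open>r0 \<ge> 0\<close> \<open>u1 \<ge> 0\<close> in auto)
  \<comment> \<open>The comparison gives the slope \<open>m / 2\<close> up to the term with
    \<open>r0\<^sup>2\<close>, which is at most half of \<open>r\<^sup>2\<close> for large
    \<open>r\<close>; this leaves \<open>m / 4\<close>.\<close>
  have "radial_profile (deriv \<phi>) (deriv (deriv \<phi>)) u v (m / 4)"
  proof
    show "\<forall>\<^sub>F r in at_top. (u has_real_derivative v r) (at r)"
      using eventually_gt_at_top[of r0] by eventually_elim (rule deriv_u)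
    show "\<forall>\<^sub>F r in at_top.
        (v has_real_derivative (1 + (v r)\<^sup>2) * (deriv \<phi> (u r) - v r / r)) (at r)"
      using eventually_gt_at_top[of r0] by eventually_elim (rule deriv_v)
    show "\<forall>\<^sub>F r in at_top. (deriv \<phi> has_real_derivative deriv (deriv \<phi>) (u r)) (at (u r))"
      using eventually_ge_at_top[of r0] by eventually_elim (intro der2 u_ray)
    show "\<forall>\<^sub>F r in at_top. deriv (deriv \<phi>) (u r) \<ge> 0"
      using eventually_ge_at_top[of r0] by eventually_elim (intro nonneg u_ray)
    show "m / 4 > 0" using \<open>m > 0\<close> by simp
    have "\<forall>\<^sub>F r in at_top. r0\<^sup>2 \<le> r\<^sup>2 / 2"
      by real_asymp
    then show "\<forall>\<^sub>F r in at_top. m / 4 * r \<le> v r"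
      using eventually_ge_at_top[of r0] eventually_gt_at_top[of 0]
    proof eventually_elim
      case (elim r)
      have "m * (r\<^sup>2 / 2) \<le> m * (r\<^sup>2 - r0\<^sup>2)"
        using elim \<open>m > 0\<close> by (intro mult_left_mono) auto
      moreover have "m * (r\<^sup>2 / 2) = 2 * (r * (m / 4 * r))"
        by (simp add: power2_eq_square)
      ultimately have "r * (m / 4 * r) \<le> r * v r"
        using rv_ge[of r] elim by linarith
      then show ?case using elim by simp
    qed
  qed
  then show ?thesis by blast
qed

section \<open>The asymptotic expansions for rotational graphs\<close>

theorem theoremA:
  fixes \<phi> u :: "real \<Rightarrow> real" and a :: ereal and c :: "nat \<Rightarrow> real"
    and \<alpha> \<beta> r0 u0 u1 :: real
  assumes smooth: "smooth_on (right_ray a) \<phi>"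
    and deriv_pos: "\<And>x. x \<in> right_ray a \<Longrightarrow> deriv \<phi> x > 0"
    and deriv2_nonneg: "\<And>x. x \<in> right_ray a \<Longrightarrow> deriv (deriv \<phi>) x \<ge> 0"
    and expansion: "\<forall>\<^sub>F x in at_top.
      (\<lambda>n. c (Suc n) / x ^ Suc n) sums (deriv \<phi> x - (\<alpha> * x + \<beta>))"
    and cases: "(\<alpha> > 0 \<and> first_nonzero_pos c) \<or> (\<alpha> = 0 \<and> \<beta> > 0 \<and> first_nonzero_neg c)"
    and r0: "r0 \<ge> 0" and u0: "u0 \<in> right_ray a" and u1: "u1 \<ge> 0"
    and graph: "rotational_minimal_graph \<phi> (right_ray a) r0 u0 u1 u"
  shows "(\<alpha> > 0 \<longrightarrow>
      (\<exists>C>0. (\<lambda>r. \<phi> (u r) - C * exp (\<alpha> * r\<^sup>2)) \<in> O[at_top](\<lambda>r. r\<^sup>2)))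
    \<and> (\<alpha> = 0 \<longrightarrow>
      strict_mono_on (right_ray a) (primitive_G \<phi> u0) \<and>
      (\<exists>d. (\<lambda>r. (primitive_G \<phi> u0 (u r) - d) - (r\<^sup>2 / 2 - ln r / \<beta>\<^sup>2))
        \<in> O[at_top](\<lambda>r. 1 / r\<^sup>2)))"
proof -
  have der1: "(\<phi> has_real_derivative deriv \<phi> x) (at x)" if "x \<in> right_ray a" for x
    using smooth[unfolded smooth_on_def, rule_format, OF that, of 0]
    by (simp add: DERIV_deriv_iff_real_differentiable)
  have der2: "(deriv \<phi> has_real_derivative deriv (deriv \<phi>) x) (at x)" if "x \<in> right_ray a" for x
    using smooth[unfolded smooth_on_def, rule_format, OF that, of 1]
    by (simp add: DERIV_deriv_iff_real_differentiable)
  have ray: "\<forall>\<^sub>F x in at_top. x \<in> right_ray a"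
    using eventually_ge_at_top[of u0] by eventually_elim (rule right_ray_upward[OF u0])
  have cont: "continuous_on (right_ray a) (deriv \<phi>)"
    by (intro continuous_at_imp_continuous_on) (auto intro: DERIV_isCont der2)
  obtain M where M: "\<forall>\<^sub>F x in at_top.
      \<bar>deriv \<phi> x - (\<alpha> * x + \<beta>)\<bar> \<le> M / x \<and> \<bar>deriv (deriv \<phi>) x - \<alpha>\<bar> \<le> M / x\<^sup>2"
    using asymptotics_of_series_in_inverse[OF expansion] by blast
  obtain v \<kappa> where "radial_profile (deriv \<phi>) (deriv (deriv \<phi>)) u v \<kappa>"
    using radial_profile_of_graph[OF der2 deriv_pos deriv2_nonneg r0 u0 u1 graph] by blast
  then interpret radial_profile "deriv \<phi>" "deriv (deriv \<phi>)" u v \<kappa> .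
  show ?thesis
  proof (intro conjI impI)
    assume "\<alpha> > 0"
    show "\<exists>C>0. (\<lambda>r. \<phi> (u r) - C * exp (\<alpha> * r\<^sup>2)) \<in> O[at_top](\<lambda>r. r\<^sup>2)"
    proof (rule potential_asymptotics)
      show "\<forall>\<^sub>F x in at_top. (\<phi> has_real_derivative deriv \<phi> x) (at x)"
        using ray by eventually_elim (rule der1)
      show "\<forall>\<^sub>F x in at_top. (deriv \<phi> has_real_derivative deriv (deriv \<phi>) x) (at x)"
        using ray by eventually_elim (rule der2)
      show "\<forall>\<^sub>F x in at_top. \<bar>deriv \<phi> x - (\<alpha> * x + \<beta>)\<bar> \<le> M / x"
        using M by eventually_elim (rule conjunct1)
      show "\<forall>\<^sub>F x in at_top. \<bar>deriv (deriv \<phi>) x - \<alpha>\<bar> \<le> M / x\<^sup>2"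
        using M by eventually_elim (rule conjunct2)
    qed (fact \<open>\<alpha> > 0\<close>)
  next
    show "strict_mono_on (right_ray a) (primitive_G \<phi> u0)"
      by (rule strict_mono_primitive_G[OF cont deriv_pos u0])
  next
    assume "\<alpha> = 0"
    then have "\<beta> > 0" using cases by simp
    \<comment> \<open>The decay rates in the height become rates in \<open>r\<close> through
      \<open>u r \<ge> \<kappa> / 4 * r\<^sup>2\<close>; the maximum lets one constant serve both
      estimates.\<close>
    define M' where "M' = max (\<bar>M\<bar> * (4 / \<kappa>)\<^sup>2) (\<bar>M\<bar> * (4 / \<kappa>))"
    have bounds: "\<forall>\<^sub>F r in at_top. deriv (deriv \<phi>) (u r) \<le> M' / r ^ 4 \<and>
        \<bar>deriv \<phi> (u r) - \<beta>\<bar> \<le> M' / r\<^sup>2"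
      using eventually_compose_filterlim[OF M u_at_top] u_lower eventually_gt_at_top[of 0]
    proof eventually_elim
      case (elim r)
      have pos: "\<kappa> / 4 * r\<^sup>2 > 0" using elim \<kappa>_pos by simp
      have "deriv (deriv \<phi>) (u r) \<le> M / (u r)\<^sup>2"
        using elim \<open>\<alpha> = 0\<close> by (simp add: abs_le_iff)
      also have "\<dots> \<le> \<bar>M\<bar> / (\<kappa> / 4 * r\<^sup>2)\<^sup>2"
        using elim pos by (intro frac_le power_mono) auto
      also have "\<dots> = \<bar>M\<bar> * (4 / \<kappa>)\<^sup>2 / r ^ 4"
        using \<kappa>_pos by (simp add: field_simps)
      also have "\<dots> \<le> M' / r ^ 4"
        using elim by (intro divide_right_mono) (auto simp: M'_def)
      finally have 1: "deriv (deriv \<phi>) (u r) \<le> M' / r ^ 4" .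
      have "\<bar>deriv \<phi> (u r) - \<beta>\<bar> \<le> M / u r"
        using elim \<open>\<alpha> = 0\<close> by simp
      also have "\<dots> \<le> \<bar>M\<bar> / (\<kappa> / 4 * r\<^sup>2)"
        using elim pos by (intro frac_le) auto
      also have "\<dots> = \<bar>M\<bar> * (4 / \<kappa>) / r\<^sup>2"
        using \<kappa>_pos by (simp add: field_simps)
      also have "\<dots> \<le> M' / r\<^sup>2"
        using elim by (intro divide_right_mono) (auto simp: M'_def)
      finally show ?case using 1 by simp
    qed
    show "\<exists>d. (\<lambda>r. (primitive_G \<phi> u0 (u r) - d) - (r\<^sup>2 / 2 - ln r / \<beta>\<^sup>2))
        \<in> O[at_top](\<lambda>r. 1 / r\<^sup>2)"
    proof (rule primitive_asymptotics)
      show "\<forall>\<^sub>F r in at_top. deriv (deriv \<phi>) (u r) \<le> M' / r ^ 4"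
        using bounds by eventually_elim (rule conjunct1)
      show "\<forall>\<^sub>F r in at_top. \<bar>deriv \<phi> (u r) - \<beta>\<bar> \<le> M' / r\<^sup>2"
        using bounds by eventually_elim (rule conjunct2)
      show "\<forall>\<^sub>F r in at_top. (primitive_G \<phi> u0 has_real_derivative 1 / deriv \<phi> (u r)) (at (u r))"
        using eventually_compose_filterlim[OF ray u_at_top]
        by eventually_elim (rule deriv_primitive_G[OF cont deriv_pos u0])
    qed (fact \<open>\<beta> > 0\<close>)
  qed
qed

end
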